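(* Let $(X_t)_{t\ge 0}$ be a regular non-explosive continuous-time Markov chain on the countable metric space $(E,d)$ with transition rates $(Q(x,y))_{x\ne y}$. Assume that $(X_t)_{t\ge0}$ has $\Gamma$-curvature bounded below by $\rho\in\mathbb{R}$ and that its jumps are bounded by $b>0$. Let $f\in\mathcal{A}\cap\mathrm{Lip}_d(E)$ with $\|\Gamma f\|_\infty<+\infty$, and let $L_{t,\rho}=(1-e^{-2\rho t})/(2\rho)$ if $\rho\ne0$ and $L_{t,0}=t$. Then for any $x\in E$, any $t>0$ and any $y>0$, $$\mathbb{P}_x\big(f(X_t)-\mathbb{E}_x[f(X_t)]\ge y\big)\le\exp\left(-\frac{y}{2b\|f\|_{\mathrm{Lip}_d}}\log\left(1+\frac{y\,b\,\|f\|_{\mathrm{Lip}_d}}{2L_{t,\rho}\|\Gamma f\|_\infty}\right)\right).$$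
   Context: $E$ is a countable set with a metric $d$ different from the trivial metric $1_{x\neq y}$. $\mathrm{Lip}_d(E)$ is the space of functions $f:E\to\mathbb{R}$ with $\|f\|_{\mathrm{Lip}_d}:=\sup_{x\ne y}|f(x)-f(y)|/d(x,y)<+\infty$, and $\|\cdot\|_\infty$ is the supremum norm on $E$. The chain $(X_t)_{t\ge0}$ is an $E$-valued regular (its rates are stable and conservative and determine the process uniquely) non-explosive continuous-time Markov chain with generator $\mathcal{L}f(x)=\sum_{y\in E}(f(y)-f(x))Q(x,y)$, where $Q(x,y)\ge0$ for $x\ne y$. $\mathbb{P}_x,\mathbb{E}_x$ refer to the chain started at $x$, and $P_tf(x)=\mathbb{E}_x[f(X_t)]$ is its semigroup. Jumps bounded by $b$: $\sup_{t>0}d(X_{t-},X_t)\le b$. It is assumed that there is an algebra $\mathcal{A}$ of real functions on $E$ which contains the bounded functions and is stable under $\mathcal{L}$, under $P_t$ and under composition with $C^\infty$-functions. For $f,g\in\mathcal{A}$, $\Gamma(f,g)(x):=\frac12\big(\mathcal{L}(fg)-f\mathcal{L}g-g\mathcal{L}f\big)(x)=\frac12\sum_{y\in E}(f(y)-f(x))(g(y)-g(x))Q(x,y)$, and $\Gamma f:=\Gamma(f,f)$. $\Gamma$-curvature bounded below by $\rho\in\mathbb{R}$ means: $(\Gamma P_tf)^{1/2}(x)\le e^{-\rho t}P_t\big((\Gamma f)^{1/2}\big)(x)$ for every $f\in\mathcal{A}$, $x\in E$, $t>0$. *)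

theory Defs
  imports "HOL-Probability.Probability"
begin

section \<open>Lipschitz functions and norms\<close>

definition trivial_metric :: "'e \<Rightarrow> 'e \<Rightarrow> real" where
  "trivial_metric x y = of_bool (x \<noteq> y)"

definition lip_quotients :: "('e \<Rightarrow> 'e \<Rightarrow> real) \<Rightarrow> ('e \<Rightarrow> real) \<Rightarrow> real set" where
  "lip_quotients d f = {\<bar>f x - f y\<bar> / d x y | x y. x \<noteq> y}"

definition Lip :: "('e \<Rightarrow> 'e \<Rightarrow> real) \<Rightarrow> ('e \<Rightarrow> real) set" where
  "Lip d = {f. bdd_above (lip_quotients d f)}"

definition lip_norm :: "('e \<Rightarrow> 'e \<Rightarrow> real) \<Rightarrow> ('e \<Rightarrow> real) \<Rightarrow> real" where
  "lip_norm d f = Sup (lip_quotients d f)"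

definition bounded_fun :: "('e \<Rightarrow> real) \<Rightarrow> bool" where
  "bounded_fun f \<longleftrightarrow> bdd_above (range (\<lambda>x. \<bar>f x\<bar>))"

definition sup_norm :: "('e \<Rightarrow> real) \<Rightarrow> real" where
  "sup_norm f = (SUP x. \<bar>f x\<bar>)"

section \<open>Transition rates\<close>

text \<open>
  Only the values \<open>Q x y\<close> with \<open>x \<noteq> y\<close> are meaningful; the diagonal of \<open>Q\<close> is never used.
  Conservativity is built into \<open>rate_matrix\<close>, whose diagonal is minus the total jump rate.
\<close>

definition stable_rates :: "('e \<Rightarrow> 'e \<Rightarrow> real) \<Rightarrow> bool" where
  "stable_rates Q \<longleftrightarrow> (\<forall>x y. x \<noteq> y \<longrightarrow> 0 \<le> Q x y) \<and> (\<forall>x. Q x summable_on - {x})"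

definition rate_matrix :: "('e \<Rightarrow> 'e \<Rightarrow> real) \<Rightarrow> 'e \<Rightarrow> 'e \<Rightarrow> real" where
  "rate_matrix Q x y = (if x = y then - (\<Sum>\<^sub>\<infinity>z\<in>- {x}. Q x z) else Q x y)"

text \<open>Transition functions are allowed to be sub-stochastic, as usual for \<open>Q\<close>-processes.\<close>

definition transition_function :: "(real \<Rightarrow> 'e \<Rightarrow> 'e \<Rightarrow> real) \<Rightarrow> bool" where
  "transition_function p \<longleftrightarrow>
     (\<forall>t\<ge>0. \<forall>x y. 0 \<le> p t x y) \<and>
     (\<forall>t\<ge>0. \<forall>x. p t x summable_on UNIV \<and> (\<Sum>\<^sub>\<infinity>y. p t x y) \<le> 1) \<and>
     (\<forall>x y. p 0 x y = of_bool (x = y)) \<and>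
     (\<forall>s\<ge>0. \<forall>t\<ge>0. \<forall>x z. p (s + t) x z = (\<Sum>\<^sub>\<infinity>y. p s x y * p t y z))"

definition has_rates :: "(real \<Rightarrow> 'e \<Rightarrow> 'e \<Rightarrow> real) \<Rightarrow> ('e \<Rightarrow> 'e \<Rightarrow> real) \<Rightarrow> bool" where
  "has_rates p Q \<longleftrightarrow>
     (\<forall>x y. ((\<lambda>t. (p t x y - of_bool (x = y)) / t) \<longlongrightarrow> rate_matrix Q x y) (at_right 0))"

definition regular_rates :: "('e \<Rightarrow> 'e \<Rightarrow> real) \<Rightarrow> bool" where
  "regular_rates Q \<longleftrightarrow> stable_rates Q \<and>
     (\<forall>p p'. transition_function p \<and> has_rates p Q \<and> transition_function p' \<and> has_rates p' Q
        \<longrightarrow> (\<forall>t\<ge>0. p t = p' t))"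

section \<open>Paths\<close>

text \<open>
  The state space carries the discrete topology, so a limit along a path means that the path is
  eventually equal to that limit. Only times \<open>t \<ge> 0\<close> matter.
\<close>

definition right_continuous_path :: "(real \<Rightarrow> 'e) \<Rightarrow> bool" where
  "right_continuous_path w \<longleftrightarrow> (\<forall>t\<ge>0. \<forall>\<^sub>F s in at_right t. w s = w t)"

definition jump_times :: "(real \<Rightarrow> 'e) \<Rightarrow> real set" where
  "jump_times w = {t. 0 < t \<and> \<not> (\<forall>\<^sub>F s in at_left t. w s = w t)}"

definition nonexplosive_path :: "(real \<Rightarrow> 'e) \<Rightarrow> bool" where
  "nonexplosive_path w \<longleftrightarrow> (\<forall>T. finite (jump_times w \<inter> {..T}))"

text \<open>Right-continuous non-explosive paths have a left limit at every positive time.\<close>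

definition left_limit :: "(real \<Rightarrow> 'e) \<Rightarrow> real \<Rightarrow> 'e" where
  "left_limit w t = (THE z. \<forall>\<^sub>F s in at_left t. w s = z)"

section \<open>The Markov chain\<close>

text \<open>
  \<open>P x\<close> is the law of the chain started at \<open>x\<close>; all these laws live on the same measurable space.
  The Markov property is stated for events of the natural filtration.
\<close>

definition past :: "'w measure \<Rightarrow> (real \<Rightarrow> 'w \<Rightarrow> 'e) \<Rightarrow> real \<Rightarrow> 'w set set" where
  "past M X s = sigma_sets (space M) {X u -` {z} \<inter> space M | u z. 0 \<le> u \<and> u \<le> s}"

locale regular_nonexplosive_chain =
  fixes Q :: "'e::countable \<Rightarrow> 'e \<Rightarrow> real"
    and P :: "'e \<Rightarrow> 'w measure"
    and X :: "real \<Rightarrow> 'w \<Rightarrow> 'e"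
  assumes prob: "\<And>x. prob_space (P x)"
    and same_sets: "\<And>x y. sets (P x) = sets (P y)"
    and measurable_X: "\<And>x t. 0 \<le> t \<Longrightarrow> X t \<in> measurable (P x) (count_space UNIV)"
    and start: "\<And>x. AE \<omega> in P x. X 0 \<omega> = x"
    and markov: "\<And>x s t y z A. 0 \<le> s \<Longrightarrow> 0 \<le> t \<Longrightarrow> A \<in> past (P x) X s \<Longrightarrow>
        measure (P x) {\<omega> \<in> A. X s \<omega> = y \<and> X (s + t) \<omega> = z} =
        measure (P x) {\<omega> \<in> A. X s \<omega> = y} * measure (P y) {\<omega> \<in> space (P y). X t \<omega> = z}"
    and right_continuous: "\<And>x. AE \<omega> in P x. right_continuous_path (\<lambda>t. X t \<omega>)"
    and nonexplosive: "\<And>x. AE \<omega> in P x. nonexplosive_path (\<lambda>t. X t \<omega>)"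
    and regular: "regular_rates Q"
    and rates: "has_rates (\<lambda>t x y. measure (P x) {\<omega> \<in> space (P x). X t \<omega> = y}) Q"

definition jumps_bounded_by ::
  "('e \<Rightarrow> 'e \<Rightarrow> real) \<Rightarrow> ('e \<Rightarrow> 'w measure) \<Rightarrow> (real \<Rightarrow> 'w \<Rightarrow> 'e) \<Rightarrow> real \<Rightarrow> bool" where
  "jumps_bounded_by d P X b \<longleftrightarrow>
     (\<forall>x. AE \<omega> in P x. \<forall>t>0. d (left_limit (\<lambda>s. X s \<omega>) t) (X t \<omega>) \<le> b)"

definition semigroup_op ::
  "('e \<Rightarrow> 'w measure) \<Rightarrow> (real \<Rightarrow> 'w \<Rightarrow> 'e) \<Rightarrow> real \<Rightarrow> ('e \<Rightarrow> real) \<Rightarrow> 'e \<Rightarrow> real" where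
  "semigroup_op P X t f x = (\<integral>\<omega>. f (X t \<omega>) \<partial>P x)"

section \<open>Generator, carre du champ and curvature\<close>

definition gen :: "('e \<Rightarrow> 'e \<Rightarrow> real) \<Rightarrow> ('e \<Rightarrow> real) \<Rightarrow> 'e \<Rightarrow> real" where
  "gen Q f x = (\<Sum>\<^sub>\<infinity>y. (f y - f x) * Q x y)"

definition Gam2 :: "('e \<Rightarrow> 'e \<Rightarrow> real) \<Rightarrow> ('e \<Rightarrow> real) \<Rightarrow> ('e \<Rightarrow> real) \<Rightarrow> 'e \<Rightarrow> real" where
  "Gam2 Q f g x = (gen Q (\<lambda>y. f y * g y) x - f x * gen Q g x - g x * gen Q f x) / 2"

definition Gam :: "('e \<Rightarrow> 'e \<Rightarrow> real) \<Rightarrow> ('e \<Rightarrow> real) \<Rightarrow> 'e \<Rightarrow> real" where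
  "Gam Q f = Gam2 Q f f"

definition smooth :: "(real \<Rightarrow> real) \<Rightarrow> bool" where
  "smooth \<phi> \<longleftrightarrow> (\<forall>n x. (deriv ^^ n) \<phi> field_differentiable at x)"

text \<open>
  Infinite sums and integrals are total functions here, so stability under the generator and under
  the semigroup includes that the defining series and expectations converge absolutely.
\<close>

locale chain_algebra = regular_nonexplosive_chain Q P X
  for Q :: "'e::countable \<Rightarrow> 'e \<Rightarrow> real"
    and P :: "'e \<Rightarrow> 'w measure"
    and X :: "real \<Rightarrow> 'w \<Rightarrow> 'e" +
  fixes \<A> :: "('e \<Rightarrow> real) set"
  assumes add_closed: "\<And>f g. f \<in> \<A> \<Longrightarrow> g \<in> \<A> \<Longrightarrow> (\<lambda>x. f x + g x) \<in> \<A>"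
    and scale_closed: "\<And>f c. f \<in> \<A> \<Longrightarrow> (\<lambda>x. c * f x) \<in> \<A>"
    and mult_closed: "\<And>f g. f \<in> \<A> \<Longrightarrow> g \<in> \<A> \<Longrightarrow> (\<lambda>x. f x * g x) \<in> \<A>"
    and bounded_mem: "\<And>f. bounded_fun f \<Longrightarrow> f \<in> \<A>"
    and gen_summable: "\<And>f x. f \<in> \<A> \<Longrightarrow> (\<lambda>y. (f y - f x) * Q x y) summable_on UNIV"
    and gen_closed: "\<And>f. f \<in> \<A> \<Longrightarrow> gen Q f \<in> \<A>"
    and semigroup_integrable: "\<And>f t x. f \<in> \<A> \<Longrightarrow> 0 \<le> t \<Longrightarrow> integrable (P x) (\<lambda>\<omega>. f (X t \<omega>))"
    and semigroup_closed: "\<And>f t. f \<in> \<A> \<Longrightarrow> 0 \<le> t \<Longrightarrow> semigroup_op P X t f \<in> \<A>"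
    and smooth_closed: "\<And>f \<phi>. f \<in> \<A> \<Longrightarrow> smooth \<phi> \<Longrightarrow> (\<lambda>x. \<phi> (f x)) \<in> \<A>"

definition Gam_curvature_ge ::
  "('e \<Rightarrow> 'e \<Rightarrow> real) \<Rightarrow> ('e \<Rightarrow> 'w measure) \<Rightarrow> (real \<Rightarrow> 'w \<Rightarrow> 'e) \<Rightarrow> ('e \<Rightarrow> real) set \<Rightarrow> real \<Rightarrow> bool"
where
  "Gam_curvature_ge Q P X \<A> \<rho> \<longleftrightarrow>
     (\<forall>f\<in>\<A>. \<forall>x. \<forall>t>0. sqrt (Gam Q (semigroup_op P X t f) x)
        \<le> exp (- \<rho> * t) * semigroup_op P X t (\<lambda>z. sqrt (Gam Q f z)) x)"

definition curv_time :: "real \<Rightarrow> real \<Rightarrow> real" where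
  "curv_time t \<rho> = (if \<rho> = 0 then t else (1 - exp (- 2 * \<rho> * t)) / (2 * \<rho>))"

end

theory Submission
  imports Defs
begin

text \<open>
  For bounded \<open>f\<close> and \<open>g = exp (a f)\<close> the function \<open>s \<mapsto> P\<^sub>s (P\<^sub>t\<^sub>-\<^sub>s f P\<^sub>t\<^sub>-\<^sub>s g)\<close> interpolates between
  \<open>P\<^sub>t f P\<^sub>t g\<close> and \<open>P\<^sub>t (f g)\<close> with derivative \<open>2 P\<^sub>s \<Gamma>(P\<^sub>t\<^sub>-\<^sub>s f, P\<^sub>t\<^sub>-\<^sub>s g)\<close>. Cauchy-Schwarz, the curvature
  bound and the jump bound, which gives \<open>\<Gamma> g \<le> ((exp (a c) - 1) / c)\<^sup>2 g\<^sup>2 \<Gamma> f\<close> with \<open>c = b \<parallel>f\<parallel>\<close>, turn this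
  into a differential inequality for the Laplace transform of \<open>f (X\<^sub>t)\<close>; Chernoff's bound then yields
  the estimate. The derivative exists because the exit rate is integrable under every \<open>P\<^sub>t (x, \<cdot>)\<close>:
  the generator maps each bounded function to an integrable one, and a gliding hump argument
  makes this uniform. Unbounded \<open>f\<close> are truncated.
\<close>

text \<open>The rates may be unbounded, so \<open>P_h f - f\<close> is of order \<open>h\<close>
  only pointwise, with the exit rate in the constant. Remainders are therefore kept linear in the
  exit rate: it is known to be integrable, its square is not. Domination must also survive a moving
  outer time. For this, laws at earlier times are compared with the law at a later time: the chain
  can first wait at its starting point, and the probability of finding it there again is bounded
  below on bounded time intervals. The jump bound speaks of paths, whereas the carre du champ sees
  only rates; observing the path on finer and finer grids shows that \<open>Q x y = 0\<close> as
  soon as \<open>d x y > b\<close>. With \<open>K = 2 L V\<close>, where \<open>V\<close> bounds the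
  carre du champ of \<open>f\<close> and \<open>L\<close> is the curvature time, and
  \<open>u = y c / K\<close>, the optimal Chernoff exponent is Bennett's
  \<open>(K / c^2) ((1 + u) ln (1 + u) - u)\<close>. The factor 1/2 in the claim comes from
  weakening the bracket to \<open>(u / 2) ln (1 + u)\<close>.\<close>

section \<open>A one-sided monotonicity criterion\<close>

text \<open>Only a lower left Dini derivative is controlled, so the mean value theorem does not
  apply. The points \<open>s\<close> from which \<open>D b\<close> is reached with slope at most
  \<open>e'\<close> form a closed set containing \<open>b\<close>; a further step to the left from
  its infimum would stay in it, so the infimum is \<open>a\<close>.\<close>

lemma nonincreasing_of_left_increments:
  fixes D :: "real \<Rightarrow> real"
  assumes "a \<le> b" and cont: "continuous_on {a..b} D"
    and incr: "\<And>s e. a < s \<Longrightarrow> s \<le> b \<Longrightarrow> 0 < e \<Longrightarrow> \<exists>h>0. h \<le> s - a \<and> D s - D (s - h) \<le> e * h"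
  shows "D b \<le> D a"
proof (rule field_le_epsilon)
  fix e :: real assume "0 < e"
  \<comment> \<open>The \<open>+ 1\<close> keeps the quotient positive when
    \<open>a = b\<close>.\<close>
  define e' where "e' = e / (b - a + 1)"
  have e': "0 < e'" using \<open>0 < e\<close> \<open>a \<le> b\<close> by (simp add: e'_def)
  define S where "S = {s \<in> {a..b}. D b + e' * s \<le> D s + e' * b}"
  have "closed S"
  proof -
    have "continuous_on {a..b} (\<lambda>s. D b + e' * s - (D s + e' * b))"
      by (intro continuous_intros cont)
    then have "closed ({a..b} \<inter> (\<lambda>s. D b + e' * s - (D s + e' * b)) -` {..0})"
      by (rule continuous_closed_preimage) auto
    also have "{a..b} \<inter> (\<lambda>s. D b + e' * s - (D s + e' * b)) -` {..0} = S"
      by (auto simp: S_def)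
    finally show ?thesis .
  qed
  have "b \<in> S" using \<open>a \<le> b\<close> by (simp add: S_def)
  have bdd: "bdd_below S" by (rule bdd_belowI[of _ a]) (auto simp: S_def)
  have "Inf S \<in> S"
    using \<open>closed S\<close> \<open>b \<in> S\<close> bdd closed_contains_Inf by blast
  then have I: "a \<le> Inf S" "Inf S \<le> b" "D b + e' * Inf S \<le> D (Inf S) + e' * b"
    by (auto simp: S_def)
  have "Inf S = a"
  proof (rule ccontr)
    assume "Inf S \<noteq> a"
    then obtain h where h: "h > 0" "h \<le> Inf S - a" "D (Inf S) - D (Inf S - h) \<le> e' * h"
      using incr[of "Inf S" e'] I e' by auto
    then have "Inf S - h \<in> S" using I by (auto simp: S_def algebra_simps)
    then show False using cInf_lower[OF _ bdd, of "Inf S - h"] h by auto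
  qed
  then have "D b \<le> D a + e' * (b - a)" using I by (simp add: algebra_simps)
  also have "e' * (b - a) \<le> e" using \<open>0 < e\<close> \<open>a \<le> b\<close>
    by (simp add: e'_def divide_simps algebra_simps)
  finally show "D b \<le> D a + e" by simp
qed

section \<open>Exit rates and the generator on bounded functions\<close>

lemma summable_on_iff_integrable_count_space:
  fixes f :: "'a \<Rightarrow> real"
  shows "f summable_on A \<longleftrightarrow> integrable (count_space A) f"
  by (metis Infinite_Set_Sum.abs_summable_on_def abs_summable_equivalent summable_on_iff_abs_summable_on_real)

text \<open>No summability is assumed: both sides default to 0 where the series does not converge
  absolutely.\<close>

lemma infsum_eq_integral_count_space:
  fixes f :: "'a \<Rightarrow> real"
  shows "infsum f A = (\<integral>x. f x \<partial>count_space A)"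
proof (cases "f summable_on A")
  case True
  then show ?thesis
    by (metis Infinite_Set_Sum.abs_summable_on_def abs_summable_equivalent infsetsum_def infsetsum_infsum
        summable_on_iff_integrable_count_space)
next
  case False
  then show ?thesis
    by (simp add: infsum_not_exists not_integrable_integral_eq summable_on_iff_integrable_count_space)
qed

text \<open>The diagonal of \<open>Q\<close> carries no information. With zeros there, exit rates
  and generators become integrals over the whole space; the diagonal term of a generator vanishes
  anyway.\<close>

definition off_diag :: "('e \<Rightarrow> 'e \<Rightarrow> real) \<Rightarrow> 'e \<Rightarrow> 'e \<Rightarrow> real" where
  "off_diag Q x y = (if x = y then 0 else Q x y)"

definition exit_rate :: "('e \<Rightarrow> 'e \<Rightarrow> real) \<Rightarrow> 'e \<Rightarrow> real" where
  "exit_rate Q x = (\<integral>y. off_diag Q x y \<partial>count_space UNIV)"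

lemma off_diag_nonneg: "stable_rates Q \<Longrightarrow> 0 \<le> off_diag Q x y"
  by (auto simp: off_diag_def stable_rates_def)

lemma off_diag_integrable:
  assumes "stable_rates Q" shows "integrable (count_space UNIV) (off_diag Q x)"
proof -
  have "Q x summable_on - {x}" using assms by (auto simp: stable_rates_def)
  then have "off_diag Q x summable_on UNIV"
    by (rule summable_on_cong_neutral[THEN iffD1, rotated -1]) (auto simp: off_diag_def)
  then show ?thesis by (simp add: summable_on_iff_integrable_count_space)
qed

lemma exit_rate_nonneg: "stable_rates Q \<Longrightarrow> 0 \<le> exit_rate Q x"
  unfolding exit_rate_def by (intro Bochner_Integration.integral_nonneg) (simp add: off_diag_nonneg)

lemma exit_rate_eq_infsum: "exit_rate Q x = (\<Sum>\<^sub>\<infinity>z\<in>- {x}. Q x z)"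
  unfolding exit_rate_def infsum_eq_integral_count_space[symmetric]
  by (rule infsum_cong_neutral) (auto simp: off_diag_def)

lemma gen_eq_integral: "gen Q f x = (\<integral>y. (f y - f x) * off_diag Q x y \<partial>count_space UNIV)"
  unfolding gen_def infsum_eq_integral_count_space
  by (rule Bochner_Integration.integral_cong) (auto simp: off_diag_def)

lemma integrable_bounded_times_off_diag:
  assumes "stable_rates Q" and "\<And>y. \<bar>f y\<bar> \<le> C"
  shows "integrable (count_space UNIV) (\<lambda>y. f y * off_diag Q x y)"
proof (rule Bochner_Integration.integrable_bound)
  show "integrable (count_space UNIV) (\<lambda>y. C * off_diag Q x y)"
    using off_diag_integrable[OF assms(1)] by simp
  have "C \<ge> 0" using assms(2)[of undefined] by linarith
  then show "AE y in count_space UNIV. norm (f y * off_diag Q x y) \<le> norm (C * off_diag Q x y)"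
    using assms off_diag_nonneg[OF assms(1)] by (auto simp: abs_mult intro!: mult_right_mono)
qed simp

lemma bounded_funD:
  assumes "bounded_fun f" obtains C where "\<And>x. \<bar>f x\<bar> \<le> C" "0 \<le> C"
proof -
  obtain C where C: "\<And>x. \<bar>f x\<bar> \<le> C" using assms unfolding bounded_fun_def bdd_above_def by auto
  moreover have "0 \<le> C" using C[of undefined] by linarith
  ultimately show ?thesis using that by blast
qed

lemma bounded_funI: "(\<And>x. \<bar>f x\<bar> \<le> C) \<Longrightarrow> bounded_fun f"
  unfolding bounded_fun_def bdd_above_def by blast

lemma bounded_fun_add:
  assumes "bounded_fun f" "bounded_fun g" shows "bounded_fun (\<lambda>x. f x + g x)"
proof -
  obtain C D where "\<And>x. \<bar>f x\<bar> \<le> C" "\<And>x. \<bar>g x\<bar> \<le> D" using assms bounded_funD by metis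
  then show ?thesis by (intro bounded_funI[of _ "C + D"]) (meson abs_triangle_ineq add_mono order_trans)
qed

lemma bounded_fun_mult:
  assumes "bounded_fun f" "bounded_fun g" shows "bounded_fun (\<lambda>x. f x * g x)"
proof -
  obtain C D where C: "\<And>x. \<bar>f x\<bar> \<le> C" "0 \<le> C" "\<And>x. \<bar>g x\<bar> \<le> D" using assms bounded_funD by metis
  show ?thesis by (rule bounded_funI[of _ "C * D"]) (use C in \<open>auto simp: abs_mult intro!: mult_mono\<close>)
qed

lemma bounded_fun_const: "bounded_fun (\<lambda>x. c)"
  by (rule bounded_funI[of _ "\<bar>c\<bar>"]) simp

lemma bounded_fun_indicator: "bounded_fun (indicator A :: _ \<Rightarrow> real)"
  by (rule bounded_funI[of _ 1]) (auto simp: indicator_def)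

lemma bounded_fun_diff: "bounded_fun f \<Longrightarrow> bounded_fun g \<Longrightarrow> bounded_fun (\<lambda>x. f x - g x)"
  using bounded_fun_add[of f "\<lambda>x. -1 * g x"] bounded_fun_mult[OF bounded_fun_const[of "-1"], of g] by simp

lemma gen_integrable:
  assumes "stable_rates Q" "bounded_fun f"
  shows "integrable (count_space UNIV) (\<lambda>y. (f y - f x) * off_diag Q x y)"
proof -
  have "bounded_fun (\<lambda>y. f y - f x)" using assms by (intro bounded_fun_diff bounded_fun_const)
  then show ?thesis using assms integrable_bounded_times_off_diag by (metis bounded_funD)
qed

lemma gen_add:
  assumes "stable_rates Q" "bounded_fun f" "bounded_fun g"
  shows "gen Q (\<lambda>y. f y + g y) x = gen Q f x + gen Q g x"
  unfolding gen_eq_integral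
  by (subst Bochner_Integration.integral_add[OF gen_integrable[OF assms(1,2)] gen_integrable[OF assms(1,3)], symmetric])
     (auto intro!: Bochner_Integration.integral_cong simp: algebra_simps)

lemma gen_scale: "gen Q (\<lambda>y. c * f y) x = c * gen Q f x"
  unfolding gen_eq_integral Bochner_Integration.integral_mult_right_zero[symmetric]
  by (auto intro!: Bochner_Integration.integral_cong simp: algebra_simps)

lemma gen_diff:
  assumes "stable_rates Q" "bounded_fun f" "bounded_fun g"
  shows "gen Q (\<lambda>y. f y - g y) x = gen Q f x - gen Q g x"
  using gen_add[OF assms(1,2), of "\<lambda>y. -1 * g y" x] gen_scale[of Q "-1" g x]
    bounded_fun_mult[OF bounded_fun_const[of "-1"] assms(3)]
  by simp

lemma abs_gen_le:
  assumes "stable_rates Q" and "\<And>y. \<bar>f y\<bar> \<le> C"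
  shows "\<bar>gen Q f x\<bar> \<le> 2 * C * exit_rate Q x"
proof -
  have *: "\<bar>f y - f x\<bar> \<le> 2 * C" for y using assms(2)[of x] assms(2)[of y] by linarith
  have "\<bar>gen Q f x\<bar> \<le> (\<integral>y. \<bar>(f y - f x) * off_diag Q x y\<bar> \<partial>count_space UNIV)"
    unfolding gen_eq_integral by (rule integral_abs_bound)
  also have "\<dots> \<le> (\<integral>y. 2 * C * off_diag Q x y \<partial>count_space UNIV)"
    using * assms off_diag_nonneg[OF assms(1)] off_diag_integrable[OF assms(1)]
    by (intro integral_mono integrable_abs gen_integrable)
       (auto simp: abs_mult intro: bounded_funI mult_right_mono)
  finally show ?thesis by (simp add: exit_rate_def)
qed

section \<open>Integrability of the exit rate\<close>

text \<open>The two indicators differ by plus or minus that of \<open>{z}\<close>, whose generator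
  at \<open>z\<close> is minus the exit rate, so their generators cannot both be small at
  \<open>z\<close>.\<close>

lemma gen_indicator_flip:
  assumes "stable_rates Q" and B: "B = (if z \<in> A then A - {z} else insert z A)"
  shows "exit_rate Q z \<le> \<bar>gen Q (indicator A) z\<bar> + \<bar>gen Q (indicator B) z\<bar>"
proof -
  have 1: "gen Q (indicator {z}) z = - exit_rate Q z"
    unfolding gen_eq_integral exit_rate_def Bochner_Integration.integral_minus[symmetric]
    by (rule Bochner_Integration.integral_cong) (auto simp: off_diag_def)
  have "\<bar>gen Q (indicator A) z - gen Q (indicator B) z\<bar> = exit_rate Q z"
  proof (cases "z \<in> A")
    case True
    have "(\<lambda>y. indicator A y - indicator B y) = (indicator {z} :: _ \<Rightarrow> real)"
      using True B by (auto simp: indicator_def)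
    then show ?thesis
      using gen_diff[OF assms(1) bounded_fun_indicator[of A] bounded_fun_indicator[of B], of z] 1 exit_rate_nonneg[OF assms(1), of z]
      by simp
  next
    case False
    have "(\<lambda>y. indicator B y - indicator A y) = (indicator {z} :: _ \<Rightarrow> real)"
      using False B by (auto simp: indicator_def)
    then show ?thesis
      using gen_diff[OF assms(1) bounded_fun_indicator[of B] bounded_fun_indicator[of A], of z] 1 exit_rate_nonneg[OF assms(1), of z]
      by simp
  qed
  then show ?thesis by linarith
qed

text \<open>Averaging over all subsets of \<open>Z\<close>: toggling \<open>z\<close> permutes
  \<open>Pow Z\<close>, so by \<open>gen_indicator_flip\<close> the average of
  \<open>|gen Q (indicator A) z|\<close> is at least half the exit rate at \<open>z\<close>. Some
  subset does at least as well as the average of the weighted sums.\<close>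

lemma exists_indicator_large_gen:
  fixes w :: "'e \<Rightarrow> real"
  assumes Q: "stable_rates Q" and "finite Z" and w: "\<And>z. 0 \<le> w z"
  shows "\<exists>A. (\<Sum>z\<in>Z. w z * exit_rate Q z) \<le> 2 * (\<Sum>z\<in>Z. w z * \<bar>gen Q (indicator A) z\<bar>)"
proof (rule ccontr)
  assume neg: "\<not> ?thesis"
  define fl where "fl z A = (if z \<in> A then A - {z} else insert z A)" for z :: 'e and A
  have bij: "bij_betw (fl z) (Pow Z) (Pow Z)" if "z \<in> Z" for z
    using that by (intro bij_betwI[of _ _ _ "fl z"]) (auto simp: fl_def split: if_splits)
  have "real (card (Pow Z)) * (\<Sum>z\<in>Z. w z * exit_rate Q z)
      = (\<Sum>z\<in>Z. w z * (\<Sum>A\<in>Pow Z. exit_rate Q z))"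
    by (simp add: sum_distrib_left algebra_simps)
  also have "\<dots> \<le> (\<Sum>z\<in>Z. w z * (\<Sum>A\<in>Pow Z. \<bar>gen Q (indicator A) z\<bar> + \<bar>gen Q (indicator (fl z A)) z\<bar>))"
    by (intro sum_mono mult_left_mono gen_indicator_flip Q w) (simp add: fl_def)
  also have "\<dots> = (\<Sum>z\<in>Z. w z * (2 * (\<Sum>A\<in>Pow Z. \<bar>gen Q (indicator A) z\<bar>)))"
  proof (intro sum.cong refl arg_cong2[where f = "(*)"])
    fix z assume "z \<in> Z"
    have "(\<Sum>A\<in>Pow Z. \<bar>gen Q (indicator (fl z A)) z\<bar>) = (\<Sum>A\<in>Pow Z. \<bar>gen Q (indicator A) z\<bar>)"
      by (rule sum.reindex_bij_betw[OF bij[OF \<open>z \<in> Z\<close>]])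
    then show "(\<Sum>A\<in>Pow Z. \<bar>gen Q (indicator A) z\<bar> + \<bar>gen Q (indicator (fl z A)) z\<bar>)
        = 2 * (\<Sum>A\<in>Pow Z. \<bar>gen Q (indicator A) z\<bar>)"
      by (simp add: sum.distrib)
  qed
  also have "\<dots> = (\<Sum>A\<in>Pow Z. 2 * (\<Sum>z\<in>Z. w z * \<bar>gen Q (indicator A) z\<bar>))"
    unfolding sum_distrib_left by (subst sum.swap) (simp add: mult.left_commute)
  also have "\<dots> < (\<Sum>A\<in>Pow Z. (\<Sum>z\<in>Z. w z * exit_rate Q z))"
    using neg \<open>finite Z\<close> by (intro sum_strict_mono) (auto simp: not_le)
  also have "\<dots> = real (card (Pow Z)) * (\<Sum>z\<in>Z. w z * exit_rate Q z)" by simp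
  finally show False by simp
qed

text \<open>
  Gliding hump: if integrability fails, superposing with weights \<open>9\<^sup>-\<^sup>k\<close> suitably signed indicators that are
  good on larger and larger finite sets gives a single bounded function violating \<open>int\<close>.
\<close>

lemma integrable_exit_rate:
  fixes Q :: "'e \<Rightarrow> 'e \<Rightarrow> real"
  assumes Q: "stable_rates Q" and w: "\<And>z. 0 \<le> w z"
    and int: "\<And>f. bounded_fun f \<Longrightarrow> integrable (count_space UNIV) (\<lambda>z. w z * gen Q f z)"
  shows "integrable (count_space UNIV) (\<lambda>z. w z * exit_rate Q z)"
proof (rule ccontr)
  define r where "r = (\<lambda>z. w z * exit_rate Q z)"
  assume "\<not> ?thesis"
  then have "\<not> r summable_on UNIV" by (simp add: summable_on_iff_integrable_count_space r_def)
  have r0: "0 \<le> r z" for z using w exit_rate_nonneg[OF Q] by (simp add: r_def)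
  have "\<exists>Z. finite Z \<and> C \<le> sum r Z" for C
  proof (rule ccontr)
    assume "\<not> ?thesis"
    then have "bdd_above (sum r ` {F. F \<subseteq> UNIV \<and> finite F})"
      by (intro bdd_aboveI[of _ C]) (auto simp: not_le less_imp_le)
    then show False
      using nonneg_bdd_above_summable_on[of UNIV r] r0 \<open>\<not> r summable_on UNIV\<close> by auto
  qed
  \<comment> \<open>The size \<open>4 * 9^k * k\<close> is chosen backwards: after the weight
    \<open>9^-k\<close> and a total loss of a factor 4, \<open>k\<close> remains.\<close>
  then have "\<exists>Z. finite Z \<and> 4 * 9 ^ k * real k \<le> sum r Z" for k by blast
  then obtain Z where Z: "finite (Z k)" "4 * 9 ^ k * real k \<le> sum r (Z k)" for k
    by metis
  \<comment> \<open>A seminorm on bounded functions: the part of the weighted L1 norm of the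
    generator that lives on \<open>Z k\<close>.\<close>
  define N where "N k f = (\<Sum>z\<in>Z k. w z * \<bar>gen Q f z\<bar>)" for k and f :: "'e \<Rightarrow> real"
  obtain A where A: "sum r (Z k) \<le> 2 * N k (indicator (A k))" for k
  proof -
    have "\<exists>A. \<forall>k. sum r (Z k) \<le> 2 * N k (indicator (A k))"
      using exists_indicator_large_gen[OF Q Z(1) w] by (intro choice) (auto simp: r_def N_def)
    then show ?thesis using that by blast
  qed
  define G where "G k = (\<lambda>z. (1/9) ^ k * indicator (A k) z :: real)" for k
  \<comment> \<open>The sign prevents cancellation with the earlier terms: the two candidates differ
    by \<open>2 G k\<close>, so the larger of their seminorms is at least that of
    \<open>G k\<close>.\<close>
  define S where "S = rec_nat (\<lambda>z. 0 :: real) (\<lambda>k s. if N k (\<lambda>z. s z - G k z) \<le> N k (\<lambda>z. s z + G k z)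
      then (\<lambda>z. s z + G k z) else (\<lambda>z. s z - G k z))"
  have S_Suc: "S (Suc k) = (if N k (\<lambda>z. S k z - G k z) \<le> N k (\<lambda>z. S k z + G k z)
      then (\<lambda>z. S k z + G k z) else (\<lambda>z. S k z - G k z))" for k
    by (simp add: S_def)
  have S_0: "S 0 = (\<lambda>z. 0)" by (simp add: S_def)
  have G: "bounded_fun (G k)" "\<bar>G k z\<bar> \<le> (1/9) ^ k" for k z
    using bounded_fun_mult[OF bounded_fun_const[of "(1/9) ^ k"] bounded_fun_indicator[of "A k"]]
    by (auto simp: G_def indicator_def)
  have Sb: "bounded_fun (S k)" for k
    by (induction k) (auto simp: S_Suc S_0 intro!: bounded_fun_add bounded_fun_diff G bounded_fun_const)
  have N_diff: "N k (\<lambda>z. f z - g z) \<le> N k f + N k g" if "bounded_fun f" "bounded_fun g" for k f g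
    unfolding N_def sum.distrib[symmetric]
    by (intro sum_mono) (use w in \<open>auto simp: gen_diff[OF Q that] distrib_left[symmetric]
      intro!: mult_left_mono abs_triangle_ineq4\<close>)
  have N_scale: "N k (\<lambda>z. c * f z) = \<bar>c\<bar> * N k f" for k c f
    unfolding N_def gen_scale abs_mult sum_distrib_left by (simp add: mult.left_commute)
  have N_le: "N k f \<le> 2 * C * sum r (Z k)" if "\<And>z. \<bar>f z\<bar> \<le> C" for k f C
    unfolding N_def r_def sum_distrib_left
    using mult_left_mono[OF abs_gen_le[OF Q that] w] by (intro sum_mono) (simp add: algebra_simps)
  have N_S: "(1/9) ^ k * sum r (Z k) \<le> 2 * N k (S (Suc k))" for k
  proof -
    have "2 * (1/9) ^ k * N k (indicator (A k)) = N k (\<lambda>z. (S k z + G k z) - (S k z - G k z))"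
    proof -
      have "(\<lambda>z. (S k z + G k z) - (S k z - G k z)) = (\<lambda>z. 2 * (1/9) ^ k * indicator (A k) z)"
        by (simp add: G_def fun_eq_iff)
      then show ?thesis using N_scale[of k "2 * (1/9) ^ k" "indicator (A k)"] by simp
    qed
    also have "\<dots> \<le> N k (\<lambda>z. S k z + G k z) + N k (\<lambda>z. S k z - G k z)"
      by (intro N_diff bounded_fun_add bounded_fun_diff Sb G)
    also have "\<dots> \<le> 2 * N k (S (Suc k))"
      by (auto simp: S_Suc)
    finally have "(1/9) ^ k * (2 * N k (indicator (A k))) \<le> 2 * N k (S (Suc k))" by simp
    then show ?thesis
      by (rule order_trans[rotated]) (intro mult_left_mono A, simp)
  qed
  define D where "D k z = S (Suc k) z - S k z" for k z
  have D: "\<bar>D k z\<bar> \<le> (1/9) ^ k" for k z using G(2)[of k z] by (auto simp: D_def S_Suc)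
  have sum_D: "summable (\<lambda>k. D k z)" for z
    by (rule summable_comparison_test[of _ "\<lambda>k. (1/9) ^ k"]) (use D in auto)
  have S_eq: "S k z = (\<Sum>i<k. D i z)" for k z
    by (induction k) (auto simp: S_0 D_def)
  define f where "f z = (\<Sum>k. D k z)" for z
  have tail: "\<bar>f z - S k z\<bar> \<le> (1/9) ^ k * (9/8)" for k z
  proof -
    have "f z - S k z = (\<Sum>i. D (i + k) z)"
      unfolding f_def S_eq using suminf_minus_initial_segment[OF sum_D] by simp
    also have "\<bar>\<dots>\<bar> \<le> (\<Sum>i. (1/9) ^ (i + k))"
    proof -
      have "norm (\<Sum>i. D (i + k) z) \<le> (\<Sum>i. (1/9) ^ (i + k))"
      proof (rule norm_suminf_le)
        show "norm (D (i + k) z) \<le> (1/9) ^ (i + k)" for i using D by simp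
        show "summable (\<lambda>i. (1/9 :: real) ^ (i + k))"
          by (rule summable_ignore_initial_segment[OF summable_geometric]) simp
      qed
      then show ?thesis by simp
    qed
    also have "\<dots> = (\<Sum>i. (1/9) ^ i) * (1/9) ^ k"
      by (simp add: power_add suminf_mult2 summable_geometric)
    also have "(\<Sum>i. (1/9 :: real) ^ i) = 9/8" by (subst suminf_geometric) auto
    finally show ?thesis by (simp add: mult.commute)
  qed
  have fb: "bounded_fun f" by (rule bounded_funI[of _ "9/8"]) (use tail[of _ 0] in \<open>simp add: S_0\<close>)
  \<comment> \<open>Up to stage \<open>k\<close> the seminorm is at least half of
    \<open>9^-k * sum r (Z k)\<close>. All later terms together are at most \<open>9^-k / 8\<close>
    in absolute value and cost at most a quarter of that quantity; this is what the small ratio 1/9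
    achieves.\<close>
  have "real k \<le> N k f" for k
  proof -
    have "N k (S (Suc k)) = N k (\<lambda>z. f z - (f z - S (Suc k) z))" by simp
    also have "\<dots> \<le> N k f + N k (\<lambda>z. f z - S (Suc k) z)"
      by (intro N_diff fb bounded_fun_diff Sb)
    also have "N k (\<lambda>z. f z - S (Suc k) z) \<le> 2 * ((1/9) ^ Suc k * (9/8)) * sum r (Z k)"
      by (rule N_le) (rule tail)
    also have "\<dots> = (1/9) ^ k * sum r (Z k) / 4" by simp
    finally have "(1/9) ^ k * sum r (Z k) / 4 \<le> N k f" using N_S[of k] by linarith
    moreover have "(1/9) ^ k * (4 * 9 ^ k * real k) \<le> (1/9) ^ k * sum r (Z k)"
      by (intro mult_left_mono Z) auto
    then have "4 * real k \<le> (1/9) ^ k * sum r (Z k)" by (simp add: power_one_over field_simps)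
    ultimately show ?thesis by linarith
  qed
  moreover have "N k f \<le> (\<integral>z. \<bar>w z * gen Q f z\<bar> \<partial>count_space UNIV)" for k
  proof -
    have "N k f = (\<Sum>z\<in>Z k. \<bar>w z * gen Q f z\<bar>)" by (simp add: N_def abs_mult w)
    also have "\<dots> \<le> (\<Sum>\<^sub>\<infinity>z. \<bar>w z * gen Q f z\<bar>)"
      using int[OF fb] Z(1)
      by (intro finite_sum_le_infsum) (auto simp: summable_on_iff_integrable_count_space)
    finally show ?thesis by (simp add: infsum_eq_integral_count_space)
  qed
  ultimately have "real k \<le> (\<integral>z. \<bar>w z * gen Q f z\<bar> \<partial>count_space UNIV)" for k
    using order_trans by blast
  then show False using reals_Archimedean2 not_le by blast
qed

section \<open>Semigroups of transition kernels with integrable exit rate\<close>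

lemma integrable_measure_pmf_bounded:
  assumes "bounded_fun (f :: _ \<Rightarrow> real)" shows "integrable (measure_pmf p) f"
proof -
  obtain C where "\<And>x. \<bar>f x\<bar> \<le> C" "0 \<le> C" using bounded_funD[OF assms] by metis
  then show ?thesis by (intro measure_pmf.integrable_const_bound[where B = C]) auto
qed

lemma expectation_eq_count_space:
  "measure_pmf.expectation p (f :: _ \<Rightarrow> real) = (\<integral>z. pmf p z * f z \<partial>count_space UNIV)"
  unfolding measure_pmf_eq_density by (subst integral_real_density) auto

lemma integrable_pmf_iff_count_space:
  "integrable (measure_pmf p) (f :: _ \<Rightarrow> real) \<longleftrightarrow> integrable (count_space UNIV) (\<lambda>z. pmf p z * f z)"
  unfolding measure_pmf_eq_density by (subst integrable_real_density) auto

lemma expectation_bind_pmf: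
  assumes "bounded_fun (f :: _ \<Rightarrow> real)"
  shows "measure_pmf.expectation (bind_pmf p k) f = measure_pmf.expectation p (\<lambda>y. measure_pmf.expectation (k y) f)"
proof -
  obtain C where "\<And>x. \<bar>f x\<bar> \<le> C" "0 \<le> C" using bounded_funD[OF assms] by metis
  then show ?thesis unfolding measure_pmf_bind
    by (intro integral_bind[where K = "count_space UNIV" and B = C and B' = 1])
       (simp_all add: measure_pmf_in_subprob_algebra Pi_def measure_pmf.finite_measure_axioms)
qed

lemma pmf_bind_ge: "pmf p y * pmf (k y) z \<le> pmf (bind_pmf p k) z"
proof -
  have "pmf p y * pmf (k y) z = measure_pmf.expectation p (\<lambda>w. indicator {y} w * pmf (k y) z)"
    by (simp add: measure_pmf_single)
  also have "\<dots> \<le> measure_pmf.expectation p (\<lambda>w. pmf (k w) z)"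
    by (intro integral_mono integrable_measure_pmf_bounded bounded_funI[of _ 1])
       (auto simp: indicator_def pmf_le_1)
  finally show ?thesis by (simp add: pmf_bind)
qed

lemma abs_expectation_le:
  "(\<And>y. \<bar>f y :: real\<bar> \<le> C) \<Longrightarrow> \<bar>measure_pmf.expectation p f\<bar> \<le> C"
  by (rule order_trans[OF integral_abs_bound])
     (auto intro!: measure_pmf.integral_le_const integrable_measure_pmf_bounded bounded_funI[of _ C])

text \<open>The analysis needs only the one-time laws, so paths are left aside and kernels are
  discrete distributions. The last assumption supplies the dominating function for limits under
  these kernels.\<close>

locale pmf_semigroup =
  fixes Q :: "'e \<Rightarrow> 'e \<Rightarrow> real" and K :: "real \<Rightarrow> 'e \<Rightarrow> 'e pmf"
  assumes stable: "stable_rates Q"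
    and K_0: "K 0 x = return_pmf x"
    and K_add: "0 \<le> s \<Longrightarrow> 0 \<le> t \<Longrightarrow> K (s + t) x = bind_pmf (K s x) (K t)"
    and K_rates: "has_rates (\<lambda>t x. pmf (K t x)) Q"
    and exit_rate_integrable: "0 \<le> t \<Longrightarrow> integrable (K t x) (exit_rate Q)"
begin

definition T :: "real \<Rightarrow> ('e \<Rightarrow> real) \<Rightarrow> 'e \<Rightarrow> real" where
  "T t f x = measure_pmf.expectation (K t x) f"

lemma T_0 [simp]: "T 0 f = f"
  by (simp add: T_def K_0 fun_eq_iff)

lemma T_add: "0 \<le> s \<Longrightarrow> 0 \<le> t \<Longrightarrow> bounded_fun f \<Longrightarrow> T (s + t) f x = T s (T t f) x"
  by (simp add: T_def[abs_def] K_add expectation_bind_pmf)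

lemma abs_T_le: "(\<And>y. \<bar>f y\<bar> \<le> C) \<Longrightarrow> \<bar>T t f x\<bar> \<le> C"
  unfolding T_def by (rule abs_expectation_le)

lemma bounded_T: "bounded_fun f \<Longrightarrow> bounded_fun (T t f)"
  by (metis abs_T_le bounded_funD bounded_funI)

section \<open>Holding probabilities and comparison of laws at different times\<close>

lemma stay_power: "0 \<le> s \<Longrightarrow> pmf (K s x) x ^ n \<le> pmf (K (real n * s) x) x"
proof (induction n)
  case 0 then show ?case by (simp add: K_0)
next
  case (Suc n)
  have "pmf (K s x) x * pmf (K s x) x ^ n \<le> pmf (K s x) x * pmf (K (real n * s) x) x"
    using Suc by (intro mult_left_mono) auto
  also have "\<dots> \<le> pmf (K (s + real n * s) x) x"
    using Suc.prems by (subst K_add) (auto intro: pmf_bind_ge)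
  finally show ?case by (simp add: algebra_simps)
qed

lemma rates_seq:
  assumes "h \<longlonglongrightarrow> 0" "\<And>n. 0 < h n"
  shows "(\<lambda>n. (pmf (K (h n) x) y - of_bool (x = y)) / h n) \<longlonglongrightarrow> rate_matrix Q x y"
proof -
  have "filterlim h (at_right 0) sequentially"
    using assms by (auto simp: filterlim_at less_imp_neq[symmetric])
  then show ?thesis
    using K_rates filterlim_compose unfolding has_rates_def by blast
qed

text \<open>The infinitesimal rate bounds the leaving probability for every \<open>h\<close>: divide
  \<open>h\<close> into equal steps, apply Bernoulli's inequality to the probability of being at
  \<open>x\<close> after each of them, and let the mesh tend to 0.\<close>

lemma leave_prob_le:
  assumes "0 \<le> h" shows "1 - pmf (K h x) x \<le> h * exit_rate Q x"
proof (cases "h = 0")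
  case False
  with assms have "0 < h" by simp
  define s where "s n = h / real (Suc n)" for n
  have s: "s \<longlonglongrightarrow> 0" "\<And>n. 0 < s n"
    unfolding s_def using \<open>0 < h\<close> LIMSEQ_Suc[OF lim_const_over_n[of h]] by auto
  have "(\<lambda>n. - ((pmf (K (s n) x) x - 1) / s n)) \<longlonglongrightarrow> exit_rate Q x"
    using tendsto_minus[OF rates_seq[OF s, of x x]] by (simp add: rate_matrix_def exit_rate_eq_infsum)
  moreover have "(1 - pmf (K h x) x) / h \<le> - ((pmf (K (s n) x) x - 1) / s n)" for n
  proof -
    have "1 + real (Suc n) * (pmf (K (s n) x) x - 1) \<le> (1 + (pmf (K (s n) x) x - 1)) ^ Suc n"
      by (rule Bernoulli_inequality) simp
    also have "\<dots> \<le> pmf (K (real (Suc n) * s n) x) x"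
      using stay_power[of "s n" x "Suc n"] s(2)[of n] by simp
    also have "real (Suc n) * s n = h" by (simp add: s_def)
    finally have "1 - pmf (K h x) x \<le> real (Suc n) * (1 - pmf (K (s n) x) x)"
      by (simp add: algebra_simps)
    then have "(1 - pmf (K h x) x) / h \<le> real (Suc n) * (1 - pmf (K (s n) x) x) / h"
      using \<open>0 < h\<close> by (intro divide_right_mono) auto
    also have "\<dots> = - ((pmf (K (s n) x) x - 1) / s n)"
      by (simp add: s_def diff_divide_distrib algebra_simps)
    finally show ?thesis .
  qed
  ultimately have "(1 - pmf (K h x) x) / h \<le> exit_rate Q x"
    by (intro LIMSEQ_le_const) auto
  then show ?thesis using \<open>0 < h\<close> by (simp add: field_simps)
qed (simp add: K_0)

lemma abs_T_diff_le:
  assumes "0 \<le> h" "\<And>y. \<bar>f y\<bar> \<le> C"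
  shows "\<bar>T h f x - f x\<bar> \<le> 2 * C * (h * exit_rate Q x)"
proof -
  have f: "bounded_fun f" using assms(2) by (rule bounded_funI)
  have "0 \<le> C" using assms(2)[of x] by linarith
  have "T h f x - f x = measure_pmf.expectation (K h x) (\<lambda>y. f y - f x)"
    unfolding T_def using f by (simp add: integrable_measure_pmf_bounded)
  also have "\<bar>\<dots>\<bar> \<le> measure_pmf.expectation (K h x) (\<lambda>y. \<bar>f y - f x\<bar>)"
    by (rule integral_abs_bound)
  also have "\<dots> \<le> measure_pmf.expectation (K h x) (\<lambda>y. 2 * C * (1 - indicator {x} y))"
  proof (intro integral_mono)
    show "\<bar>f y - f x\<bar> \<le> 2 * C * (1 - indicator {x} y)" for y
      using assms(2)[of x] assms(2)[of y] by (auto simp: indicator_def)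
  qed (intro integrable_abs integrable_measure_pmf_bounded bounded_fun_diff bounded_fun_mult bounded_fun_const
       bounded_fun_indicator f)+
  also have "\<dots> = 2 * C * (1 - pmf (K h x) x)"
    by (simp add: measure_pmf_single integrable_measure_pmf_bounded bounded_fun_indicator)
  also have "\<dots> \<le> 2 * C * (h * exit_rate Q x)"
    using leave_prob_le[OF assms(1)] \<open>0 \<le> C\<close> by (intro mult_left_mono) auto
  finally show ?thesis .
qed

text \<open>Divide the time into \<open>n\<close> steps so short that each leaving probability is at
  most 1/2. The bound is uniform in \<open>r\<close>, as the comparison of laws at different times
  requires.\<close>

lemma stay_lower_bound: "\<exists>c>0. \<forall>r\<in>{0..t}. c \<le> pmf (K r x) x"
proof -
  obtain n where n: "2 * (\<bar>t\<bar> * exit_rate Q x) + 1 \<le> real n" using real_arch_simple by blast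
  have "n > 0" using n mult_nonneg_nonneg[OF abs_ge_zero[of t] exit_rate_nonneg[OF stable, of x]]
    by (cases n) auto
  have "(1/2) ^ n \<le> pmf (K r x) x" if "r \<in> {0..t}" for r
  proof -
    have "r * exit_rate Q x \<le> \<bar>t\<bar> * exit_rate Q x"
      using that by (intro mult_right_mono exit_rate_nonneg stable) auto
    then have "r / real n * exit_rate Q x \<le> 1/2"
      using n \<open>n > 0\<close> by (simp add: field_simps)
    then have "1/2 \<le> pmf (K (r / real n) x) x"
    proof -
      have "1 - pmf (K (r / real n) x) x \<le> r / real n * exit_rate Q x"
        using that by (intro leave_prob_le) simp
      with \<open>r / real n * exit_rate Q x \<le> 1/2\<close> show ?thesis by linarith
    qed
    then have "(1/2) ^ n \<le> pmf (K (r / real n) x) x ^ n" by (intro power_mono) auto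
    also have "\<dots> \<le> pmf (K (real n * (r / real n)) x) x"
      using that by (intro stay_power) auto
    finally show ?thesis using \<open>n > 0\<close> by simp
  qed
  then show ?thesis by (intro exI[of _ "(1/2) ^ n"]) auto
qed

text \<open>One way to be at \<open>z\<close> at time \<open>t\<close> is to be back at
  \<open>x\<close> after \<open>t - s\<close>. Together with \<open>stay_lower_bound\<close>, the
  law at \<open>t\<close> dominates all earlier laws up to one constant.\<close>

lemma pmf_mono_in_time:
  "0 \<le> s \<Longrightarrow> s \<le> t \<Longrightarrow> pmf (K (t - s) x) x * pmf (K s x) z \<le> pmf (K t x) z"
  using pmf_bind_ge[of "K (t - s) x" x "K s" z] K_add[of "t - s" s x] by simp

text \<open>The extra time \<open>h n\<close> is spent at the beginning, so the error is of order
  \<open>h n\<close> with the exit rate at the fixed point \<open>x\<close>.\<close>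

lemma pmf_tendsto:
  assumes "h \<longlonglongrightarrow> 0" "\<And>n. 0 \<le> h n" "\<And>n. h n \<le> s"
  shows "(\<lambda>n. pmf (K (s - h n) x) z) \<longlonglongrightarrow> pmf (K s x) z"
proof -
  have pmf_T: "pmf (K r x) z = T r (indicator {z}) x" for r
    unfolding T_def by (simp add: measure_pmf_single)
  have "norm (pmf (K (s - h n) x) z - pmf (K s x) z) \<le> 2 * (h n * exit_rate Q x)" for n
  proof -
    have "pmf (K s x) z = T (h n + (s - h n)) (indicator {z}) x"
      unfolding pmf_T by simp
    also have "\<dots> = T (h n) (T (s - h n) (indicator {z})) x"
      using assms(2)[of n] assms(3)[of n] by (intro T_add bounded_fun_indicator) auto
    finally have 1: "pmf (K s x) z = T (h n) (T (s - h n) (indicator {z})) x" .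
    have "\<bar>T (s - h n) (indicator {z}) y\<bar> \<le> 1" for y
      by (rule abs_T_le) (simp add: indicator_def)
    from abs_T_diff_le[of "h n" "T (s - h n) (indicator {z})" 1 x, OF assms(2)[of n] this] show ?thesis
      unfolding 1 unfolding pmf_T by (simp add: abs_minus_commute)
  qed
  then have "\<forall>\<^sub>F n in sequentially.
      norm (pmf (K (s - h n) x) z - pmf (K s x) z) \<le> 2 * (h n * exit_rate Q x)"
    by (rule always_eventually[OF allI])
  moreover have "(\<lambda>n. 2 * (h n * exit_rate Q x)) \<longlonglongrightarrow> 0"
    by (rule tendsto_mult_right_zero[OF tendsto_mult_left_zero[OF assms(1)]])
  ultimately show ?thesis
    by (rule LIM_zero_cancel[OF Lim_null_comparison])
qed

text \<open>Scheffe's lemma: off the diagonal the quotients converge pointwise to the rates, and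
  since the rates are conservative their total mass converges to the exit rate. The resulting L1
  convergence suffices against a bounded function.\<close>

lemma generator_limit:
  assumes h: "h \<longlonglongrightarrow> 0" "\<And>n. 0 < h n" and f: "bounded_fun f"
  shows "(\<lambda>n. (T (h n) f x - f x) / h n) \<longlonglongrightarrow> gen Q f x"
proof -
  define a where "a n y = (if y = x then 0 else pmf (K (h n) x) y / h n)" for n y
  have a_int: "integrable (count_space UNIV) (a n)" for n
  proof (rule Bochner_Integration.integrable_bound)
    show "integrable (count_space UNIV) (\<lambda>y. pmf (K (h n) x) y / h n)"
      by (intro integrable_divide integrable_pmf)
  qed (use h(2)[of n] in \<open>auto simp: a_def\<close>)
  have int_a: "(\<integral>y. a n y \<partial>count_space UNIV) = - ((pmf (K (h n) x) x - 1) / h n)" for n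
  proof -
    have "(\<integral>y. a n y \<partial>count_space UNIV) = (\<integral>y. pmf (K (h n) x) y * ((1 - indicator {x} y) / h n) \<partial>count_space UNIV)"
      by (rule Bochner_Integration.integral_cong) (auto simp: a_def)
    also have "\<dots> = (1 - pmf (K (h n) x) x) / h n"
      unfolding expectation_eq_count_space[symmetric]
      by (simp add: measure_pmf_single integrable_measure_pmf_bounded bounded_fun_indicator)
    finally show ?thesis by (simp add: diff_divide_distrib)
  qed
  have lim: "(\<lambda>n. \<integral>\<^sup>+y. norm (a n y - off_diag Q x y) \<partial>count_space UNIV) \<longlonglongrightarrow> 0"
  proof (rule Scheffe_lemma1)
    show "AE y in count_space UNIV. (\<lambda>n. a n y) \<longlonglongrightarrow> off_diag Q x y"
    proof (rule AE_I2)
      fix y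
      show "(\<lambda>n. a n y) \<longlonglongrightarrow> off_diag Q x y"
        using rates_seq[OF h, of x y] by (cases "x = y") (auto simp: a_def off_diag_def rate_matrix_def)
    qed
    have "(\<lambda>n. ennreal (\<integral>y. a n y \<partial>count_space UNIV)) \<longlonglongrightarrow> ennreal (exit_rate Q x)"
      unfolding int_a using tendsto_minus[OF rates_seq[OF h, of x x]]
      by (intro tendsto_ennrealI) (simp add: rate_matrix_def exit_rate_eq_infsum)
    moreover have "(\<integral>\<^sup>+ y. norm (a n y) \<partial>count_space UNIV) = ennreal (\<integral>y. a n y \<partial>count_space UNIV)" for n
      using a_int[of n] h(2)[of n] by (subst nn_integral_eq_integral[symmetric]) (auto simp: a_def intro!: nn_integral_cong)
    moreover have "(\<integral>\<^sup>+ y. norm (off_diag Q x y) \<partial>count_space UNIV) = ennreal (exit_rate Q x)"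
      unfolding exit_rate_def using off_diag_integrable[OF stable] off_diag_nonneg[OF stable]
      by (subst nn_integral_eq_integral[symmetric]) (auto intro!: nn_integral_cong)
    ultimately show "limsup (\<lambda>n. \<integral>\<^sup>+ y. norm (a n y) \<partial>count_space UNIV) \<le> (\<integral>\<^sup>+ y. norm (off_diag Q x y) \<partial>count_space UNIV)"
      by (simp add: lim_imp_Limsup)
  qed (auto simp: a_int off_diag_integrable stable)
  obtain C where C: "\<And>y. \<bar>f y\<bar> \<le> C" "0 \<le> C" using bounded_funD[OF f] by metis
  have fx: "\<bar>f y - f x\<bar> \<le> 2 * C" for y using C(1)[of x] C(1)[of y] by linarith
  have d_int: "integrable (count_space UNIV) (\<lambda>y. a n y - off_diag Q x y)" for n
    by (intro Bochner_Integration.integrable_diff a_int off_diag_integrable stable)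
  have lim': "(\<lambda>n. \<integral>y. \<bar>a n y - off_diag Q x y\<bar> \<partial>count_space UNIV) \<longlonglongrightarrow> 0"
  proof -
    have "(\<integral>\<^sup>+y. norm (a n y - off_diag Q x y) \<partial>count_space UNIV) = ennreal (\<integral>y. \<bar>a n y - off_diag Q x y\<bar> \<partial>count_space UNIV)" for n
      using d_int[of n] by (subst nn_integral_eq_integral[symmetric]) auto
    then have "(\<lambda>n. ennreal (\<integral>y. \<bar>a n y - off_diag Q x y\<bar> \<partial>count_space UNIV)) \<longlonglongrightarrow> ennreal 0"
      using lim by simp
    then show ?thesis by (subst (asm) tendsto_ennreal_iff) auto
  qed
  have eq: "(T (h n) f x - f x) / h n - gen Q f x = (\<integral>y. (f y - f x) * (a n y - off_diag Q x y) \<partial>count_space UNIV)" for n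
  proof -
    have "T (h n) f x - f x = measure_pmf.expectation (K (h n) x) (\<lambda>y. f y - f x)"
      unfolding T_def using f by (simp add: integrable_measure_pmf_bounded)
    then have "(T (h n) f x - f x) / h n = (\<integral>y. pmf (K (h n) x) y * (f y - f x) / h n \<partial>count_space UNIV)"
      by (simp add: expectation_eq_count_space)
    also have "\<dots> = (\<integral>y. (f y - f x) * a n y \<partial>count_space UNIV)"
      by (rule Bochner_Integration.integral_cong) (auto simp: a_def)
    finally have 1: "(T (h n) f x - f x) / h n = (\<integral>y. (f y - f x) * a n y \<partial>count_space UNIV)" .
    have "integrable (count_space UNIV) (\<lambda>y. (f y - f x) * a n y)"
    proof (rule Bochner_Integration.integrable_bound)
      show "integrable (count_space UNIV) (\<lambda>y. 2 * C * a n y)" by (simp add: a_int)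
      show "AE y in count_space UNIV. norm ((f y - f x) * a n y) \<le> norm (2 * C * a n y)"
        using fx \<open>0 \<le> C\<close> by (auto simp: abs_mult intro!: AE_I2 mult_right_mono)
    qed simp
    from Bochner_Integration.integral_diff[OF this gen_integrable[OF stable f]]
    show ?thesis unfolding 1 gen_eq_integral by (simp only: right_diff_distrib)
  qed
  show ?thesis
  proof (rule Lim_null_comparison[THEN LIM_zero_cancel])
    show "\<forall>\<^sub>F n in sequentially. norm ((T (h n) f x - f x) / h n - gen Q f x)
        \<le> 2 * C * (\<integral>y. \<bar>a n y - off_diag Q x y\<bar> \<partial>count_space UNIV)"
    proof (rule always_eventually, intro allI)
      fix n
      have "norm ((T (h n) f x - f x) / h n - gen Q f x)
          \<le> (\<integral>y. \<bar>(f y - f x) * (a n y - off_diag Q x y)\<bar> \<partial>count_space UNIV)"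
        unfolding eq real_norm_def by (rule integral_abs_bound)
      also have "\<dots> \<le> (\<integral>y. 2 * C * \<bar>a n y - off_diag Q x y\<bar> \<partial>count_space UNIV)"
      proof (rule integral_mono')
        show "integrable (count_space UNIV) (\<lambda>y. 2 * C * \<bar>a n y - off_diag Q x y\<bar>)"
          using d_int by simp
      qed (use fx \<open>0 \<le> C\<close> in \<open>auto simp: abs_mult intro!: mult_right_mono\<close>)
      finally show "norm ((T (h n) f x - f x) / h n - gen Q f x)
        \<le> 2 * C * (\<integral>y. \<bar>a n y - off_diag Q x y\<bar> \<partial>count_space UNIV)" by simp
    qed
    show "(\<lambda>n. 2 * C * (\<integral>y. \<bar>a n y - off_diag Q x y\<bar> \<partial>count_space UNIV)) \<longlonglongrightarrow> 0"
      using tendsto_mult_right_zero[OF lim'] by simp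
  qed
qed

section \<open>Short-time covariances and the interpolation\<close>

definition cov :: "real \<Rightarrow> ('e \<Rightarrow> real) \<Rightarrow> ('e \<Rightarrow> real) \<Rightarrow> 'e \<Rightarrow> real" where
  "cov h u v z = T h (\<lambda>y. u y * v y) z - T h u z * T h v z"

text \<open>Divided by \<open>h\<close>, the first three terms tend to twice the carre du champ; the
  last is a product of two increments and disappears in the limit.\<close>

lemma cov_eq:
  "cov h u v z = (T h (\<lambda>y. u y * v y) z - u z * v z) - u z * (T h v z - v z) - v z * (T h u z - u z)
     - (T h u z - u z) * (T h v z - v z)"
  by (simp add: cov_def algebra_simps)

text \<open>Of the constant 10, the first three terms of \<open>cov_eq\<close> take 2 each and the
  product of increments takes 4.\<close>

lemma abs_cov_le:
  assumes "0 \<le> h" and u: "\<And>y. \<bar>u y\<bar> \<le> A" and v: "\<And>y. \<bar>v y\<bar> \<le> B"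
  shows "\<bar>cov h u v z\<bar> \<le> 10 * A * B * (h * exit_rate Q z)"
proof -
  define r where "r = h * exit_rate Q z"
  have "0 \<le> A" "0 \<le> B" using u[of z] v[of z] by linarith+
  have "0 \<le> r" using assms(1) exit_rate_nonneg[OF stable] by (simp add: r_def)
  have uv: "\<bar>u y * v y\<bar> \<le> A * B" for y
    unfolding abs_mult using u v \<open>0 \<le> A\<close> by (intro mult_mono) auto
  have 1: "\<bar>T h (\<lambda>y. u y * v y) z - u z * v z\<bar> \<le> 2 * (A * B) * r"
    unfolding r_def by (rule abs_T_diff_le[OF assms(1) uv])
  have dv: "\<bar>T h v z - v z\<bar> \<le> 2 * B * r"
    unfolding r_def by (rule abs_T_diff_le[OF assms(1) v])
  have du: "\<bar>T h u z - u z\<bar> \<le> 2 * A * r"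
    unfolding r_def by (rule abs_T_diff_le[OF assms(1) u])
  \<comment> \<open>In the product of the two increments only one factor is charged to the exit
    rate; charging both would produce its square.\<close>
  have "\<bar>T h v z\<bar> \<le> B" by (rule abs_T_le[OF v])
  then have dv': "\<bar>T h v z - v z\<bar> \<le> 2 * B" using v[of z] by linarith
  have 2: "\<bar>u z * (T h v z - v z)\<bar> \<le> A * (2 * B * r)"
    unfolding abs_mult using u dv \<open>0 \<le> A\<close> by (intro mult_mono) auto
  have 3: "\<bar>v z * (T h u z - u z)\<bar> \<le> B * (2 * A * r)"
    unfolding abs_mult using v du \<open>0 \<le> B\<close> by (intro mult_mono) auto
  have 4: "\<bar>(T h u z - u z) * (T h v z - v z)\<bar> \<le> (2 * A * r) * (2 * B)"
    unfolding abs_mult using du dv' \<open>0 \<le> A\<close> \<open>0 \<le> r\<close> by (intro mult_mono) auto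
  have "\<bar>cov h u v z\<bar> \<le> 2 * (A * B) * r + A * (2 * B * r) + B * (2 * A * r) + (2 * A * r) * (2 * B)"
    unfolding cov_eq using 1 2 3 4 by linarith
  also have "\<dots> = 10 * A * B * r" by (simp add: algebra_simps)
  finally show ?thesis by (simp add: r_def)
qed

lemma cov_limit:
  assumes h: "h \<longlonglongrightarrow> 0" "\<And>n. 0 < h n" and u: "bounded_fun u" and v: "bounded_fun v"
  shows "(\<lambda>n. cov (h n) u v z / h n) \<longlonglongrightarrow> 2 * Gam2 Q u v z"
proof -
  note lu = generator_limit[OF h u, of z] and lv = generator_limit[OF h v, of z]
    and luv = generator_limit[OF h bounded_fun_mult[OF u v], of z]
  have "(\<lambda>n. (T (h n) (\<lambda>y. u y * v y) z - u z * v z) / h n - u z * ((T (h n) v z - v z) / h n)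
      - v z * ((T (h n) u z - u z) / h n) - h n * ((T (h n) u z - u z) / h n * ((T (h n) v z - v z) / h n)))
    \<longlonglongrightarrow> gen Q (\<lambda>y. u y * v y) z - u z * gen Q v z - v z * gen Q u z - 0 * (gen Q u z * gen Q v z)"
    by (intro tendsto_diff tendsto_mult tendsto_const lu lv luv h(1))
  moreover have "gen Q (\<lambda>y. u y * v y) z - u z * gen Q v z - v z * gen Q u z - 0 * (gen Q u z * gen Q v z)
      = 2 * Gam2 Q u v z" by (simp add: Gam2_def)
  moreover have "cov (h n) u v z / h n = (T (h n) (\<lambda>y. u y * v y) z - u z * v z) / h n - u z * ((T (h n) v z - v z) / h n)
      - v z * ((T (h n) u z - u z) / h n) - h n * ((T (h n) u z - u z) / h n * ((T (h n) v z - v z) / h n))" for n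
    using h(2)[of n] by (simp add: cov_eq field_simps)
  ultimately show ?thesis by simp
qed

lemma integrable_exit_bound:
  assumes "0 \<le> t" "\<And>z. \<bar>g z\<bar> \<le> C * exit_rate Q z"
  shows "integrable (K t x) g"
proof (rule Bochner_Integration.integrable_bound)
  show "integrable (K t x) (\<lambda>z. C * exit_rate Q z)"
    using exit_rate_integrable[OF assms(1)] by simp
  show "AE z in K t x. norm (g z) \<le> norm (C * exit_rate Q z)"
    using assms(2) by (auto intro!: AE_I2 order_trans[OF _ abs_ge_self])
qed simp

lemma cov_integrable:
  assumes "0 \<le> t" "0 \<le> h" "bounded_fun u" "bounded_fun v"
  shows "integrable (K t x) (cov h u v)"
proof -
  obtain A B where "\<And>y. \<bar>u y\<bar> \<le> A" "\<And>y. \<bar>v y\<bar> \<le> B" using assms bounded_funD by metis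
  from abs_cov_le[OF assms(2) this] show ?thesis
    by (intro integrable_exit_bound[where C = "10 * A * B * h"] assms(1)) (simp add: mult.assoc)
qed

lemma Gam2_integrable:
  assumes "0 \<le> t" "bounded_fun u" "bounded_fun v"
  shows "integrable (K t x) (Gam2 Q u v)"
proof -
  obtain A B where AB: "\<And>y. \<bar>u y\<bar> \<le> A" "0 \<le> A" "\<And>y. \<bar>v y\<bar> \<le> B" "0 \<le> B" using assms bounded_funD by metis
  have "\<bar>Gam2 Q u v z\<bar> \<le> 3 * A * B * exit_rate Q z" for z
  proof -
    have "\<bar>gen Q (\<lambda>y. u y * v y) z\<bar> \<le> 2 * (A * B) * exit_rate Q z"
      by (rule abs_gen_le[OF stable]) (use AB in \<open>auto simp: abs_mult intro!: mult_mono\<close>)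
    moreover have "\<bar>u z * gen Q v z\<bar> \<le> A * (2 * B * exit_rate Q z)"
      unfolding abs_mult using AB by (intro mult_mono abs_gen_le stable) auto
    moreover have "\<bar>v z * gen Q u z\<bar> \<le> B * (2 * A * exit_rate Q z)"
      unfolding abs_mult using AB by (intro mult_mono abs_gen_le stable) auto
    moreover have "2 * Gam2 Q u v z = gen Q (\<lambda>y. u y * v y) z - u z * gen Q v z - v z * gen Q u z"
      by (simp add: Gam2_def)
    ultimately have "2 * \<bar>Gam2 Q u v z\<bar> \<le> 2 * (A * B) * exit_rate Q z + A * (2 * B * exit_rate Q z)
        + B * (2 * A * exit_rate Q z)" by linarith
    then show ?thesis by (simp add: algebra_simps)
  qed
  then show ?thesis by (rule integrable_exit_bound[OF assms(1)])
qed

text \<open>The Lipschitz constant of \<open>interp\<close> needs one bound for all intermediate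
  times. It comes from the law at \<open>t\<close>, which dominates \<open>c\<close> times the law
  at \<open>s\<close>.\<close>

lemma T_exit_rate_bounded: "\<exists>M. \<forall>s\<in>{0..t}. T s (exit_rate Q) x \<le> M"
proof -
  obtain c where c: "c > 0" "\<And>r. r \<in> {0..t} \<Longrightarrow> c \<le> pmf (K r x) x" using stay_lower_bound[of t x] by auto
  have "T s (exit_rate Q) x \<le> T t (exit_rate Q) x / c" if s: "s \<in> {0..t}" for s
  proof -
    have "T s (exit_rate Q) x = (\<integral>z. pmf (K s x) z * exit_rate Q z \<partial>count_space UNIV)"
      by (simp add: T_def expectation_eq_count_space)
    also have "\<dots> \<le> (\<integral>z. (pmf (K t x) z * exit_rate Q z) / c \<partial>count_space UNIV)"
    proof (rule integral_mono)
      show "integrable (count_space UNIV) (\<lambda>z. pmf (K s x) z * exit_rate Q z)"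
        "integrable (count_space UNIV) (\<lambda>z. pmf (K t x) z * exit_rate Q z / c)"
        using s exit_rate_integrable by (auto simp: integrable_pmf_iff_count_space[symmetric])
      fix z
      have "c * pmf (K s x) z \<le> pmf (K (t - s) x) x * pmf (K s x) z"
        using c(2)[of "t - s"] s by (intro mult_right_mono) auto
      also have "\<dots> \<le> pmf (K t x) z" using s by (intro pmf_mono_in_time) auto
      finally have "c * pmf (K s x) z * exit_rate Q z \<le> pmf (K t x) z * exit_rate Q z"
        by (intro mult_right_mono exit_rate_nonneg stable)
      then show "pmf (K s x) z * exit_rate Q z \<le> pmf (K t x) z * exit_rate Q z / c"
        using c(1) by (simp add: field_simps)
    qed
    also have "\<dots> = T t (exit_rate Q) x / c" by (simp add: T_def expectation_eq_count_space)
    finally show ?thesis .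
  qed
  then show ?thesis by blast
qed

definition interp :: "real \<Rightarrow> ('e \<Rightarrow> real) \<Rightarrow> ('e \<Rightarrow> real) \<Rightarrow> 'e \<Rightarrow> real \<Rightarrow> real" where
  "interp t f g x s = T s (\<lambda>z. T (t - s) f z * T (t - s) g z) x"

text \<open>By the semigroup property both values are averages under the law at
  \<open>s - h\<close>; the remaining time \<open>h\<close> acts on the product in the first and on
  each factor in the second.\<close>

lemma interp_increment:
  assumes "0 \<le> h" "h \<le> s" "s \<le> t" and f: "bounded_fun f" and g: "bounded_fun g"
  shows "interp t f g x s - interp t f g x (s - h) = T (s - h) (cov h (T (t - s) f) (T (t - s) g)) x"
proof -
  let ?u = "T (t - s) f" and ?v = "T (t - s) g"
  have b: "bounded_fun (\<lambda>y. ?u y * ?v y)" by (intro bounded_fun_mult bounded_T f g)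
  have 1: "interp t f g x s = T (s - h) (T h (\<lambda>y. ?u y * ?v y)) x"
    using T_add[of "s - h" h "\<lambda>y. ?u y * ?v y" x] b assms by (simp add: interp_def)
  have 2: "T (t - (s - h)) f z = T h ?u z" "T (t - (s - h)) g z = T h ?v z" for z
    using T_add[of h "t - s" f z] T_add[of h "t - s" g z] assms by (simp_all add: algebra_simps)
  have "interp t f g x (s - h) = T (s - h) (\<lambda>z. T h ?u z * T h ?v z) x"
    unfolding interp_def 2 ..
  then show ?thesis unfolding 1 cov_def[abs_def] unfolding T_def[of "s - h"]
    by (subst Bochner_Integration.integral_diff)
       (auto intro!: integrable_measure_pmf_bounded bounded_T bounded_fun_mult f g)
qed

lemma continuous_interp:
  assumes f: "bounded_fun f" and g: "bounded_fun g"
  shows "continuous_on {0..t} (interp t f g x)"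
proof -
  obtain A where A: "\<And>y. \<bar>f y\<bar> \<le> A" "0 \<le> A" using bounded_funD[OF f] by metis
  obtain B where B: "\<And>y. \<bar>g y\<bar> \<le> B" "0 \<le> B" using bounded_funD[OF g] by metis
  note AB = A B
  obtain M where M: "\<And>s. s \<in> {0..t} \<Longrightarrow> T s (exit_rate Q) x \<le> M" using T_exit_rate_bounded[of t x] by blast
  define L where "L = \<bar>10 * A * B * M\<bar>"
  have *: "\<bar>interp t f g x s - interp t f g x r\<bar> \<le> L * (s - r)" if "0 \<le> r" "r \<le> s" "s \<le> t" for r s
  proof -
    let ?c = "cov (s - r) (T (t - s) f) (T (t - s) g)"
    have eq: "interp t f g x s - interp t f g x r = T r ?c x"
      using interp_increment[of "s - r" s t f g x] that f g by simp
    have int_c: "integrable (K r x) ?c"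
      by (rule cov_integrable) (use that in \<open>auto intro: bounded_T f g\<close>)
    have int_q: "integrable (K r x) (\<lambda>z. 10 * A * B * ((s - r) * exit_rate Q z))"
      by (intro integrable_mult_right exit_rate_integrable that(1))
    have c_le: "\<bar>?c z\<bar> \<le> 10 * A * B * ((s - r) * exit_rate Q z)" for z
    proof (rule abs_cov_le)
      show "0 \<le> s - r" using that by simp
    qed (rule abs_T_le, rule AB)+
    have "\<bar>T r ?c x\<bar> \<le> measure_pmf.expectation (K r x) (\<lambda>z. \<bar>?c z\<bar>)"
      unfolding T_def[of r] by (rule integral_abs_bound)
    also have "\<dots> \<le> measure_pmf.expectation (K r x) (\<lambda>z. 10 * A * B * ((s - r) * exit_rate Q z))"
      by (rule integral_mono[OF integrable_abs[OF int_c] int_q c_le])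
    also have "\<dots> = 10 * A * B * (s - r) * T r (exit_rate Q) x"
      by (simp add: T_def)
    also have "\<dots> \<le> 10 * A * B * (s - r) * M"
      using AB M that by (intro mult_left_mono) auto
    also have "\<dots> = (10 * A * B * M) * (s - r)" by simp
    also have "\<dots> \<le> L * (s - r)" unfolding L_def using that by (intro mult_right_mono) auto
    finally show ?thesis unfolding eq .
  qed
  have "L-lipschitz_on {0..t} (interp t f g x)"
  proof (rule lipschitz_onI)
    fix r s assume rs: "r \<in> {0..t}" "s \<in> {0..t}"
    show "dist (interp t f g x r) (interp t f g x s) \<le> L * dist r s"
    proof (cases "r \<le> s")
      case True
      then have "\<bar>interp t f g x s - interp t f g x r\<bar> \<le> L * (s - r)" using rs by (intro *) auto
      then show ?thesis using True by (simp add: dist_real_def abs_minus_commute)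
    next
      case False
      then have "\<bar>interp t f g x r - interp t f g x s\<bar> \<le> L * (r - s)" using rs by (intro *) auto
      then show ?thesis using False by (simp add: dist_real_def)
    qed
  qed (simp add: L_def)
  then show ?thesis by (rule lipschitz_on_continuous_on)
qed

text \<open>
  The left derivative is the convenient one: the functions whose covariance appears in
  \<open>interp_increment\<close> then do not depend on the increment.
\<close>

lemma interp_left_derivative:
  assumes s: "0 < s" "s \<le> t" and f: "bounded_fun f" and g: "bounded_fun g"
    and h: "h \<longlonglongrightarrow> 0" "\<And>n. 0 < h n" "\<And>n. h n \<le> s"
  shows "(\<lambda>n. (interp t f g x s - interp t f g x (s - h n)) / h n)
    \<longlonglongrightarrow> 2 * T s (Gam2 Q (T (t - s) f) (T (t - s) g)) x"
proof -
  let ?u = "T (t - s) f" and ?v = "T (t - s) g"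
  have u: "bounded_fun ?u" and v: "bounded_fun ?v" by (intro bounded_T f g)+
  obtain A where A: "\<And>y. \<bar>?u y\<bar> \<le> A" "0 \<le> A" using bounded_funD[OF u] by metis
  obtain B where B: "\<And>y. \<bar>?v y\<bar> \<le> B" "0 \<le> B" using bounded_funD[OF v] by metis
  note AB = A B
  obtain c where c: "c > 0" "\<And>r. r \<in> {0..s} \<Longrightarrow> c \<le> pmf (K r x) x" using stay_lower_bound[of s x] by auto
  define w where "w n z = pmf (K (s - h n) x) z * (cov (h n) ?u ?v z / h n)" for n z
  have inc: "(interp t f g x s - interp t f g x (s - h n)) / h n = (\<integral>z. w n z \<partial>count_space UNIV)" for n
  proof -
    have "interp t f g x s - interp t f g x (s - h n) = T (s - h n) (cov (h n) ?u ?v) x"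
      using interp_increment[of "h n" s t f g x] s f g h(2)[of n] h(3)[of n] by simp
    then show ?thesis by (simp add: T_def[of "s - h n"] expectation_eq_count_space w_def)
  qed
  have "(\<lambda>n. \<integral>z. w n z \<partial>count_space UNIV) \<longlonglongrightarrow> (\<integral>z. pmf (K s x) z * (2 * Gam2 Q ?u ?v z) \<partial>count_space UNIV)"
  \<comment> \<open>The majorant must not depend on \<open>n\<close>: the law at the moving time
    \<open>s - h n\<close> is at most \<open>1 / c\<close> times the law at
    \<open>s\<close>.\<close>
  proof (rule integral_dominated_convergence[where w = "\<lambda>z. 10 * A * B / c * (pmf (K s x) z * exit_rate Q z)"])
    show "integrable (count_space UNIV) (\<lambda>z. 10 * A * B / c * (pmf (K s x) z * exit_rate Q z))"
      using exit_rate_integrable[of s x] s by (simp add: integrable_pmf_iff_count_space)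
    show "AE z in count_space UNIV. (\<lambda>n. w n z) \<longlonglongrightarrow> pmf (K s x) z * (2 * Gam2 Q ?u ?v z)"
      unfolding w_def using h s less_imp_le[OF h(2)]
      by (intro AE_I2 tendsto_mult pmf_tendsto cov_limit u v) auto
    show "AE z in count_space UNIV. norm (w n z) \<le> 10 * A * B / c * (pmf (K s x) z * exit_rate Q z)" for n
    proof (rule AE_I2)
      fix z
      have "\<bar>cov (h n) ?u ?v z\<bar> \<le> 10 * A * B * (h n * exit_rate Q z)"
        using AB less_imp_le[OF h(2)] by (intro abs_cov_le) auto
      then have 1: "\<bar>cov (h n) ?u ?v z / h n\<bar> \<le> 10 * A * B * exit_rate Q z"
        using h(2)[of n] by (simp add: field_simps)
      have "c * pmf (K (s - h n) x) z \<le> pmf (K (s - (s - h n)) x) x * pmf (K (s - h n) x) z"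
        using c(2)[of "h n"] s h(3)[of n] h(2)[of n] by (intro mult_right_mono) auto
      also have "\<dots> \<le> pmf (K s x) z" using h(3)[of n] h(2)[of n] by (intro pmf_mono_in_time) auto
      finally have 2: "pmf (K (s - h n) x) z \<le> pmf (K s x) z / c" using c(1) by (simp add: field_simps)
      have "norm (w n z) = pmf (K (s - h n) x) z * \<bar>cov (h n) ?u ?v z / h n\<bar>"
        unfolding w_def real_norm_def abs_mult by simp
      also have "\<dots> \<le> pmf (K s x) z / c * (10 * A * B * exit_rate Q z)"
        using 1 2 c(1) by (intro mult_mono) auto
      finally show "norm (w n z) \<le> 10 * A * B / c * (pmf (K s x) z * exit_rate Q z)"
        by (simp add: algebra_simps)
    qed
  qed auto
  also have "(\<integral>z. pmf (K s x) z * (2 * Gam2 Q ?u ?v z) \<partial>count_space UNIV) = 2 * T s (Gam2 Q ?u ?v) x"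
    unfolding expectation_eq_count_space[symmetric] by (simp add: T_def[of s])
  finally show ?thesis unfolding inc .
qed

text \<open>The end values of \<open>interp\<close> differ by the covariance at time
  \<open>t\<close>, and \<open>E\<close> is an antiderivative of a bound on its left
  derivative.\<close>

lemma covariance_le:
  assumes "0 \<le> t" and f: "bounded_fun f" and g: "bounded_fun g"
    and E: "\<And>s. (E has_real_derivative E' s) (at s)"
    and le: "\<And>s. 0 < s \<Longrightarrow> s \<le> t \<Longrightarrow> 2 * T s (Gam2 Q (T (t - s) f) (T (t - s) g)) x \<le> E' s"
  shows "cov t f g x \<le> E t - E 0"
proof -
  define D where "D s = interp t f g x s - E s" for s
  have "D t \<le> D 0"
  proof (rule nonincreasing_of_left_increments[where D = D])
    have "continuous_on {0..t} E" using E DERIV_isCont by (intro continuous_at_imp_continuous_on) blast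
    then show "continuous_on {0..t} D"
      unfolding D_def by (intro continuous_on_diff continuous_interp f g)
    fix s e :: real assume s: "0 < s" "s \<le> t" and e: "0 < e"
    \<comment> \<open>A null sequence in \<open>(0, s]\<close>; the monotonicity criterion asks for
      just one good step for each \<open>e\<close>.\<close>
    define h where "h n = s / real (Suc n)" for n
    have h: "h \<longlonglongrightarrow> 0" "\<And>n. 0 < h n" "\<And>n. h n \<le> s"
      unfolding h_def using \<open>0 < s\<close> LIMSEQ_Suc[OF lim_const_over_n[of s]] by (auto simp: field_simps)
    have 1: "(\<lambda>n. (E s - E (s - h n)) / h n) \<longlonglongrightarrow> E' s"
    proof -
      have "filterlim (\<lambda>n. - h n) (at 0) sequentially"
        using tendsto_minus[OF h(1)] h(2) by (auto simp: filterlim_at less_imp_neq[symmetric])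
      from filterlim_compose[OF E[of s, unfolded DERIV_def] this]
      show ?thesis by (simp add: minus_divide_right[symmetric] diff_divide_distrib)
    qed
    have "(\<lambda>n. (interp t f g x s - interp t f g x (s - h n)) / h n - (E s - E (s - h n)) / h n)
      \<longlonglongrightarrow> 2 * T s (Gam2 Q (T (t - s) f) (T (t - s) g)) x - E' s"
      by (intro tendsto_diff interp_left_derivative s f g h 1)
    moreover have "2 * T s (Gam2 Q (T (t - s) f) (T (t - s) g)) x - E' s < e"
      using le[OF s] e by linarith
    ultimately have "\<forall>\<^sub>F n in sequentially.
        (interp t f g x s - interp t f g x (s - h n)) / h n - (E s - E (s - h n)) / h n < e"
      by (rule order_tendstoD(2))
    then obtain n where "(interp t f g x s - interp t f g x (s - h n)) / h n - (E s - E (s - h n)) / h n < e"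
      unfolding eventually_sequentially by blast
    then have "(D s - D (s - h n)) / h n < e" by (simp add: D_def diff_divide_distrib)
    then have "D s - D (s - h n) \<le> e * h n" using h(2)[of n] by (simp add: field_simps)
    then show "\<exists>h>0. h \<le> s - 0 \<and> D s - D (s - h) \<le> e * h" using h by auto
  qed (fact assms(1))
  moreover have "D t - D 0 = cov t f g x - (E t - E 0)"
    using assms(1) by (simp add: D_def interp_def cov_def)
  ultimately show ?thesis by linarith
qed

end

section \<open>The kernels of the chain\<close>

context regular_nonexplosive_chain
begin

text \<open>The state space is countable, so the law of \<open>X t\<close> is discrete. The value is
  meaningful for \<open>0 <= t\<close>, where \<open>X t\<close> is measurable.\<close>

definition ker :: "real \<Rightarrow> 'e \<Rightarrow> 'e pmf" where
  "ker t x = Abs_pmf (distr (P x) (count_space UNIV) (X t))"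

lemma stable_Q: "stable_rates Q"
  using regular by (simp add: regular_rates_def)

lemma measure_pmf_ker:
  assumes "0 \<le> t" shows "measure_pmf (ker t x) = distr (P x) (count_space UNIV) (X t)"
  unfolding ker_def
proof (rule Abs_pmf_inverse, intro CollectI conjI)
  interpret prob_space "P x" by (rule prob)
  show *: "prob_space (distr (P x) (count_space UNIV) (X t))"
    by (rule prob_space_distr[OF measurable_X[OF assms]])
  interpret D: prob_space "distr (P x) (count_space UNIV) (X t)" by (fact *)
  show "AE y in distr (P x) (count_space UNIV) (X t). measure (distr (P x) (count_space UNIV) (X t)) {y} \<noteq> 0"
    by (subst D.AE_support_countable) (auto intro!: exI[of _ UNIV])
qed simp

lemma pmf_ker:
  assumes "0 \<le> t" shows "pmf (ker t x) y = measure (P x) {\<omega> \<in> space (P x). X t \<omega> = y}"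
proof -
  have "pmf (ker t x) y = measure (P x) (X t -` {y} \<inter> space (P x))"
    by (simp add: pmf.rep_eq measure_pmf_ker assms measure_distr[OF measurable_X[OF assms]])
  also have "X t -` {y} \<inter> space (P x) = {\<omega> \<in> space (P x). X t \<omega> = y}" by auto
  finally show ?thesis .
qed

lemma expectation_ker:
  assumes "0 \<le> t" shows "measure_pmf.expectation (ker t x) f = semigroup_op P X t f x"
  unfolding measure_pmf_ker[OF assms] semigroup_op_def
  by (rule integral_distr[OF measurable_X[OF assms]]) simp

lemma integrable_ker:
  fixes f :: "'e \<Rightarrow> real"
  assumes "0 \<le> t" shows "integrable (ker t x) f \<longleftrightarrow> integrable (P x) (\<lambda>\<omega>. f (X t \<omega>))"
  unfolding measure_pmf_ker[OF assms]
  by (rule integrable_distr_eq[OF measurable_X[OF assms]]) simp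

lemma sets_X: "0 \<le> t \<Longrightarrow> {\<omega> \<in> space (P x). X t \<omega> \<in> B} \<in> sets (P x)"
  using measurable_sets[OF measurable_X, of t B x] by (simp add: vimage_def Int_def conj_commute)

lemma sets_X_eq: "0 \<le> t \<Longrightarrow> {\<omega> \<in> space (P x). X t \<omega> = y} \<in> sets (P x)"
  using sets_X[of t x "{y}"] by simp

lemma ker_0: "ker 0 x = return_pmf x"
proof (rule pmf_eqI)
  fix y
  interpret prob_space "P x" by (rule prob)
  show "pmf (ker 0 x) y = pmf (return_pmf x) y"
  proof (cases "x = y")
    case True
    have "prob {\<omega> \<in> space (P x). X 0 \<omega> = x} = 1"
      using start[of x] by (subst prob_eq_1) (auto simp: sets_X_eq)
    then show ?thesis using True by (simp add: pmf_ker)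
  next
    case False
    have "prob {\<omega> \<in> space (P x). X 0 \<omega> = y} = 0"
      using start[of x] False by (subst prob_eq_0) (auto simp: sets_X_eq elim: eventually_mono)
    then show ?thesis using False by (simp add: pmf_ker)
  qed
qed

lemma ker_add:
  assumes "0 \<le> s" "0 \<le> t" shows "ker (s + t) x = bind_pmf (ker s x) (ker t)"
proof (rule pmf_eqI)
  fix z
  interpret prob_space "P x" by (rule prob)
  define B where "B y = {\<omega> \<in> space (P x). X s \<omega> = y \<and> X (s + t) \<omega> = z}" for y
  have B_sets: "B y \<in> sets (P x)" for y
  proof -
    have "B y = {\<omega> \<in> space (P x). X s \<omega> = y} \<inter> {\<omega> \<in> space (P x). X (s + t) \<omega> = z}"
      by (auto simp: B_def)
    then show ?thesis using assms by (auto intro!: sets.Int sets_X_eq)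
  qed
  \<comment> \<open>Chapman-Kolmogorov uses the Markov property with the whole space as past
    event.\<close>
  have "space (P x) \<in> past (P x) X s" unfolding past_def by (rule sigma_sets_top)
  from markov[OF assms this, of _ z] have pB: "prob (B y) = pmf (ker s x) y * pmf (ker t y) z" for y
    using assms by (simp add: B_def pmf_ker)
  have "ennreal (pmf (ker (s + t) x) z) = emeasure (P x) (\<Union>y\<in>UNIV. B y)"
    using assms by (auto simp: pmf_ker emeasure_eq_measure B_def intro!: arg_cong[where f = prob])
  also have "\<dots> = (\<integral>\<^sup>+ y. emeasure (P x) (B y) \<partial>count_space UNIV)"
    by (rule emeasure_UN_countable) (auto simp: B_sets disjoint_family_on_def, auto simp: B_def)
  also have "\<dots> = (\<integral>\<^sup>+ y. ennreal (pmf (ker s x) y) * ennreal (pmf (ker t y) z) \<partial>count_space UNIV)"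
    by (simp add: emeasure_eq_measure pB ennreal_mult)
  also have "\<dots> = ennreal (pmf (bind_pmf (ker s x) (ker t)) z)"
    by (simp add: ennreal_pmf_bind nn_integral_measure_pmf)
  finally show "pmf (ker (s + t) x) z = pmf (bind_pmf (ker s x) (ker t)) z" by simp
qed

end

sublocale chain_algebra \<subseteq> pmf_semigroup Q ker
proof
  show "stable_rates Q" by (rule stable_Q)
  show "ker 0 x = return_pmf x" for x by (rule ker_0)
  show "ker (s + t) x = bind_pmf (ker s x) (ker t)" if "0 \<le> s" "0 \<le> t" for s t x
    using that by (rule ker_add)
  show "has_rates (\<lambda>t x. pmf (ker t x)) Q"
    unfolding has_rates_def
  proof (intro allI)
    fix x y
    have "((\<lambda>t. (measure (P x) {\<omega> \<in> space (P x). X t \<omega> = y} - of_bool (x = y)) / t) \<longlongrightarrow> rate_matrix Q x y) (at_right 0)"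
      using rates by (simp add: has_rates_def)
    then show "((\<lambda>t. (pmf (ker t x) y - of_bool (x = y)) / t) \<longlongrightarrow> rate_matrix Q x y) (at_right 0)"
      by (rule Lim_transform_eventually) (auto simp: eventually_at_filter pmf_ker intro!: always_eventually)
  qed
  show "integrable (ker t x) (exit_rate Q)" if "0 \<le> t" for t x
    unfolding integrable_pmf_iff_count_space
  proof (rule integrable_exit_rate[OF stable_Q])
    fix f :: "'e \<Rightarrow> real" assume "bounded_fun f"
    then have "integrable (P x) (\<lambda>\<omega>. gen Q f (X t \<omega>))"
      by (intro semigroup_integrable gen_closed bounded_mem that)
    then show "integrable (count_space UNIV) (\<lambda>z. pmf (ker t x) z * gen Q f z)"
      unfolding integrable_pmf_iff_count_space[symmetric] integrable_ker[OF that] .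
  qed simp
qed

context chain_algebra
begin

lemma T_eq_semigroup_op: "0 \<le> t \<Longrightarrow> T t f = semigroup_op P X t f"
  by (simp add: T_def expectation_ker fun_eq_iff)

end

section \<open>Jumps of the paths and jump rates\<close>

text \<open>Without jumps the path is locally constant. Numbering the states turns it into a real
  function with derivative 0, so constancy follows from the mean value theorem.\<close>

lemma path_constant:
  fixes w :: "real \<Rightarrow> 'e :: countable"
  assumes rc: "right_continuous_path w" and "0 \<le> a" "a \<le> c" and nj: "\<And>u. a < u \<Longrightarrow> u \<le> c \<Longrightarrow> u \<notin> jump_times w"
  shows "w c = w a"
proof (cases "a = c")
  case False
  with \<open>a \<le> c\<close> have "a < c" by simp
  define f where "f u = real (to_nat (w u))" for u
  have right: "\<forall>\<^sub>F s in at_right u. f s = f u" if "0 \<le> u" for u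
    using rc that unfolding right_continuous_path_def by (auto simp: f_def elim!: eventually_mono)
  have left: "\<forall>\<^sub>F s in at_left u. f s = f u" if "a < u" "u \<le> c" for u
  proof -
    have "\<forall>\<^sub>F s in at_left u. w s = w u" using nj[OF that] that \<open>0 \<le> a\<close> by (auto simp: jump_times_def)
    then show ?thesis by (rule eventually_mono) (simp add: f_def)
  qed
  have "f c = f a"
  proof (rule DERIV_isconst_end[OF \<open>a < c\<close>])
    have lim: "(f \<longlongrightarrow> f u) (at u within S)" if "\<forall>\<^sub>F s in at u within S. f s = f u" for u S
      using tendsto_eventually[OF that] .
    show "continuous_on {a..c} f"
      unfolding continuous_on_def
    proof
      fix u assume u: "u \<in> {a..c}"
      consider "u = a" | "u = c" | "a < u" "u < c" using u by fastforce
      then show "(f \<longlongrightarrow> f u) (at u within {a..c})"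
      proof cases
        case 1
        then show ?thesis using lim[OF right[of a]] \<open>0 \<le> a\<close> \<open>a < c\<close> by (simp add: at_within_Icc_at_right)
      next
        case 2
        then show ?thesis using lim[OF left[of c]] \<open>a < c\<close> by (simp add: at_within_Icc_at_left)
      next
        case 3
        then have "(f \<longlongrightarrow> f u) (at u)"
          using lim[OF right[of u]] lim[OF left[of u]] \<open>0 \<le> a\<close> by (simp add: filterlim_split_at)
        then show ?thesis using at_le[of "{a..c}" UNIV u] tendsto_mono by fastforce
      qed
    qed
    fix u assume u: "a < u" "u < c"
    have "\<forall>\<^sub>F s in at u. f s = f u"
      unfolding at_eq_sup_left_right eventually_sup using left[of u] right[of u] u \<open>0 \<le> a\<close> by auto
    then have "\<forall>\<^sub>F s in nhds u. f s = f u"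
      by (auto simp: eventually_at_filter elim!: eventually_mono)
    then show "DERIV f u :> 0"
      by (subst DERIV_cong_ev[OF refl _ refl]) auto
  qed
  then show ?thesis by (simp add: f_def)
qed simp

text \<open>If the states at two observation times differ and at most one jump lies between, the
  path is constant before and after it, so the observed transition is a genuine jump.\<close>

lemma path_single_jump:
  fixes w :: "real \<Rightarrow> 'e :: countable"
  assumes rc: "right_continuous_path w" and a: "0 \<le> a" "a \<le> c" and ne: "w a \<noteq> w c"
    and one: "\<And>u v. u \<in> jump_times w \<Longrightarrow> v \<in> jump_times w \<Longrightarrow> a < u \<Longrightarrow> u \<le> c \<Longrightarrow> a < v \<Longrightarrow> v \<le> c \<Longrightarrow> u = v"
  shows "\<exists>u>0. left_limit w u = w a \<and> w u = w c"
proof -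
  obtain u where u: "a < u" "u \<le> c" "u \<in> jump_times w"
  proof (rule ccontr)
    assume "\<not> thesis"
    then have "w c = w a" using that by (intro path_constant[OF rc a]) blast
    then show False using ne by simp
  qed
  have nj: "v \<notin> jump_times w" if "a < v" "v \<le> c" "v \<noteq> u" for v
    using one[of v u] that u by blast
  have before: "w s = w a" if "a \<le> s" "s < u" for s
  proof (rule path_constant[OF rc a(1) that(1)])
    fix v assume "a < v" "v \<le> s"
    then show "v \<notin> jump_times w" using that u by (intro nj) auto
  qed
  have "w c = w u"
  proof (rule path_constant[OF rc _ u(2)])
    show "0 \<le> u" using u a by simp
    fix v assume "u < v" "v \<le> c"
    then show "v \<notin> jump_times w" using u by (intro nj) auto
  qed
  moreover have "left_limit w u = w a"
  proof -
    have ev: "\<forall>\<^sub>F s in at_left u. w s = w a"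
      unfolding eventually_at_left[OF u(1)] using before u(1) less_imp_le by blast
    show ?thesis unfolding left_limit_def
    proof (rule the_equality)
      show "\<forall>\<^sub>F s in at_left u. w s = w a" by (rule ev)
      fix z assume "\<forall>\<^sub>F s in at_left u. w s = z"
      then have "\<forall>\<^sub>F s in at_left u. z = w a" using ev by eventually_elim simp
      then show "z = w a" by simp
    qed
  qed
  ultimately show ?thesis using u a by (intro exI[of _ u]) auto
qed

text \<open>Up to time 1 there are finitely many jumps, hence a positive minimal gap
  \<open>e\<close>; it suffices that the mesh is smaller than \<open>e\<close>.\<close>

lemma eventually_single_jump:
  assumes "nonexplosive_path w"
  shows "\<forall>\<^sub>F n in sequentially. \<forall>k<n. \<forall>u v. u \<in> jump_times w \<longrightarrow> v \<in> jump_times w \<longrightarrow>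
    real k / real n < u \<longrightarrow> u \<le> real (Suc k) / real n \<longrightarrow> real k / real n < v \<longrightarrow> v \<le> real (Suc k) / real n \<longrightarrow> u = v"
proof -
  define J where "J = jump_times w \<inter> {..1}"
  have "finite J" using assms by (simp add: nonexplosive_path_def J_def)
  define S where "S = (\<lambda>(u, v). \<bar>u - v\<bar>) ` (J \<times> J) - {0}"
  \<comment> \<open>Inserting 1 keeps the minimum defined when there are fewer than two
    jumps.\<close>
  define e where "e = Min (insert 1 S)"
  have "finite S" using \<open>finite J\<close> by (simp add: S_def)
  then have e: "0 < e" by (auto simp: e_def S_def)
  have gap: "u = v" if "u \<in> J" "v \<in> J" "\<bar>u - v\<bar> < e" for u v
  proof (rule ccontr)
    assume "u \<noteq> v"
    then have "\<bar>u - v\<bar> \<in> S" using that by (auto simp: S_def)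
    then have "e \<le> \<bar>u - v\<bar>" using \<open>finite S\<close> by (auto simp: e_def)
    then show False using that by simp
  qed
  obtain N where N: "1 / e < real N" using reals_Archimedean2 by blast
  show ?thesis
  proof (rule eventually_sequentiallyI[of "max 1 N"], intro allI impI)
    fix n k u v assume n: "max 1 N \<le> n" and k: "k < n" and uv: "u \<in> jump_times w" "v \<in> jump_times w"
      "real k / real n < u" "u \<le> real (Suc k) / real n" "real k / real n < v" "v \<le> real (Suc k) / real n"
    have "1 / e < real n" using N n by linarith
    then have "1 / real n < e" using e n by (simp add: field_simps)
    moreover have "real (Suc k) / real n - real k / real n = 1 / real n"
      by (simp add: diff_divide_distrib[symmetric])
    ultimately have "\<bar>u - v\<bar> < e" using uv by linarith
    moreover have "real (Suc k) / real n \<le> 1" using k by simp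
    ultimately show "u = v" using uv by (intro gap) (auto simp: J_def)
  qed
qed

section \<open>Transitions observed on a time grid\<close>

context chain_algebra
begin

lemma past_mono: "s \<le> t \<Longrightarrow> past (P x) X s \<subseteq> past (P x) X t"
  unfolding past_def by (rule sigma_sets_mono') (auto intro: order_trans)

lemma past_Int: "A \<in> past (P x) X s \<Longrightarrow> B \<in> past (P x) X s \<Longrightarrow> A \<inter> B \<in> past (P x) X s"
proof -
  interpret sigma_algebra "space (P x)" "past (P x) X s"
    unfolding past_def by (rule sigma_algebra_sigma_sets) auto
  show "A \<in> past (P x) X s \<Longrightarrow> B \<in> past (P x) X s \<Longrightarrow> A \<inter> B \<in> past (P x) X s" by (rule Int)
qed

lemma past_X: "0 \<le> s \<Longrightarrow> X s -` {y} \<inter> space (P x) \<in> past (P x) X s"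
  unfolding past_def by (rule sigma_sets.Basic) blast

definition stay :: "'e \<Rightarrow> real \<Rightarrow> nat \<Rightarrow> 'w set" where
  "stay x s j = {\<omega> \<in> space (P x). \<forall>k\<le>j. X (real k * s) \<omega> = x}"

lemma stay_Suc: "stay x s (Suc j) = stay x s j \<inter> (X (real (Suc j) * s) -` {x} \<inter> space (P x))"
  by (auto simp: stay_def le_Suc_eq)

lemma stay_past: "0 \<le> s \<Longrightarrow> stay x s j \<in> past (P x) X (real j * s)"
proof (induction j)
  case 0
  have "stay x s 0 = X 0 -` {x} \<inter> space (P x)" by (auto simp: stay_def)
  then show ?case using past_X[of 0 x x] by simp
next
  case (Suc j)
  have "stay x s j \<in> past (P x) X (real (Suc j) * s)"
    using Suc past_mono[of "real j * s" "real (Suc j) * s" x] by (auto simp: algebra_simps)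
  then show ?case unfolding stay_Suc using Suc.prems by (intro past_Int past_X) auto
qed

lemma measure_stay_step:
  assumes "0 \<le> s"
  shows "measure (P x) {\<omega> \<in> stay x s j. X (real (Suc j) * s) \<omega> = z} = measure (P x) (stay x s j) * pmf (ker s x) z"
proof -
  have eq: "{\<omega> \<in> stay x s j. X (real j * s) \<omega> = x \<and> X (real j * s + s) \<omega> = z} = {\<omega> \<in> stay x s j. X (real (Suc j) * s) \<omega> = z}"
    "{\<omega> \<in> stay x s j. X (real j * s) \<omega> = x} = stay x s j"
    by (auto simp: stay_def algebra_simps)
  show ?thesis
    using markov[OF _ assms stay_past[OF assms, of x j], of x z] assms unfolding eq by (simp add: pmf_ker)
qed

lemma measure_stay: "0 \<le> s \<Longrightarrow> measure (P x) (stay x s j) = pmf (ker s x) x ^ j"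
proof (induction j)
  case 0
  have "stay x s 0 = {\<omega> \<in> space (P x). X 0 \<omega> = x}" by (auto simp: stay_def)
  then show ?case using pmf_ker[of 0 x x] by (simp add: ker_0)
next
  case (Suc j)
  have "stay x s (Suc j) = {\<omega> \<in> stay x s j. X (real (Suc j) * s) \<omega> = x}"
    unfolding stay_Suc by (auto simp: stay_def)
  then show ?case using measure_stay_step[OF Suc.prems, of x j x] Suc by simp
qed

lemma stay_sets: "0 \<le> s \<Longrightarrow> stay x s j \<in> sets (P x)"
proof (induction j)
  case 0
  have "stay x s 0 = {\<omega> \<in> space (P x). X 0 \<omega> = x}" by (auto simp: stay_def)
  then show ?case by (simp add: sets_X_eq)
next
  case (Suc j)
  have "stay x s (Suc j) = stay x s j \<inter> {\<omega> \<in> space (P x). X (real (Suc j) * s) \<omega> = x}"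
    by (auto simp: stay_Suc)
  then show ?case using Suc by (auto intro!: sets.Int sets_X_eq)
qed

definition direct_jump :: "'e \<Rightarrow> 'e \<Rightarrow> nat \<Rightarrow> 'w set" where
  "direct_jump x y n = {\<omega> \<in> space (P x). \<exists>k<n. X (real k / real n) \<omega> = x \<and> X (real (Suc k) / real n) \<omega> = y}"

lemma direct_jump_sets: "direct_jump x y n \<in> sets (P x)"
proof -
  have "direct_jump x y n = (\<Union>k<n. {\<omega> \<in> space (P x). X (real k / real n) \<omega> = x} \<inter> {\<omega> \<in> space (P x). X (real (Suc k) / real n) \<omega> = y})"
    by (auto simp: direct_jump_def)
  then show ?thesis by (auto intro!: sets.finite_UN sets.Int sets_X_eq)
qed

text \<open>Split by the step \<open>j\<close> at which the chain is first seen away from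
  \<open>x\<close>. These events are disjoint, with probability \<open>p^j\<close> times the
  one-step probability of reaching \<open>y\<close>. Lowering \<open>p^j\<close> to
  \<open>p^n\<close> makes the \<open>n\<close> summands equal, and \<open>p^n\<close> stays away
  from 0 as \<open>n\<close> grows.\<close>

lemma direct_jump_prob_ge:
  assumes "x \<noteq> y"
  shows "real n * (pmf (ker (1 / real n) x) x ^ n * pmf (ker (1 / real n) x) y) \<le> measure (P x) (direct_jump x y n)"
proof -
  interpret prob_space "P x" by (rule prob)
  define s where "s = 1 / real n"
  have "0 \<le> s" by (simp add: s_def)
  define B where "B j = {\<omega> \<in> stay x s j. X (real (Suc j) * s) \<omega> = y}" for j
  have B_sets: "B j \<in> sets (P x)" for j
  proof -
    have "B j = stay x s j \<inter> {\<omega> \<in> space (P x). X (real (Suc j) * s) \<omega> = y}"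
      by (auto simp: B_def stay_def)
    then show ?thesis using \<open>0 \<le> s\<close> by (auto intro!: sets.Int stay_sets sets_X_eq)
  qed
  \<comment> \<open>For \<open>i < j\<close>, a path in \<open>B j\<close> is still at
    \<open>x\<close> at grid time \<open>i + 1\<close>, where a path in \<open>B i\<close> is at
    \<open>y\<close>.\<close>
  have disj: "B i \<inter> B j = {}" if "i < j" for i j
  proof -
    have "X (real (Suc i) * s) \<omega> = x" if "\<omega> \<in> B j" for \<omega>
      using that \<open>i < j\<close> unfolding B_def stay_def mem_Collect_eq by (meson Suc_leI)
    then show ?thesis using assms by (auto simp: B_def)
  qed
  have disj': "disjoint_family_on B {..<n}"
    unfolding disjoint_family_on_def using disj by (metis Int_commute linorder_neqE_nat)
  have "real n * (pmf (ker s x) x ^ n * pmf (ker s x) y) = (\<Sum>j<n. pmf (ker s x) x ^ n * pmf (ker s x) y)" by simp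
  also have "\<dots> \<le> (\<Sum>j<n. prob (B j))"
  proof (rule sum_mono)
    fix j assume "j \<in> {..<n}"
    then have "pmf (ker s x) x ^ n \<le> pmf (ker s x) x ^ j"
      by (intro power_decreasing) (auto simp: pmf_le_1)
    then show "pmf (ker s x) x ^ n * pmf (ker s x) y \<le> prob (B j)"
      unfolding B_def measure_stay_step[OF \<open>0 \<le> s\<close>] measure_stay[OF \<open>0 \<le> s\<close>] by (rule mult_right_mono) simp
  qed
  also have "\<dots> = prob (\<Union>j<n. B j)"
    by (rule finite_measure_finite_Union[symmetric]) (use B_sets disj' in auto)
  also have "\<dots> \<le> prob (direct_jump x y n)"
  proof (rule finite_measure_mono[OF _ direct_jump_sets])
    show "(\<Union>j<n. B j) \<subseteq> direct_jump x y n"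
      by (auto simp: B_def stay_def direct_jump_def s_def)
  qed
  finally show ?thesis by (simp add: s_def)
qed

text \<open>
  If \<open>Q x y > 0\<close>, direct transitions from \<open>x\<close> to \<open>y\<close> seen on a grid of mesh \<open>1 / n\<close> keep a positive
  probability as \<open>n \<rightarrow> \<infinity>\<close>; but a path with finitely many jumps eventually shows such a transition
  only if it has a jump from \<open>x\<close> to \<open>y\<close>.
\<close>

lemma jump_rate_zero:
  assumes d: "jumps_bounded_by d P X b" and "x \<noteq> y" and "\<not> d x y \<le> b"
  shows "Q x y = 0"
proof -
  interpret prob_space "P x" by (rule prob)
  have "AE \<omega> in P x. \<forall>\<^sub>F n in sequentially. \<omega> \<notin> direct_jump x y n"
    using right_continuous[of x] nonexplosive[of x] d[unfolded jumps_bounded_by_def, rule_format, of x]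
  proof eventually_elim
    case (elim \<omega>)
    let ?w = "\<lambda>t. X t \<omega>"
    from eventually_single_jump[OF elim(2)] show ?case
    proof eventually_elim
      case (elim n)
      note one = elim
      show ?case
      proof
        assume "\<omega> \<in> direct_jump x y n"
        then obtain k where k: "k < n" "?w (real k / real n) = x" "?w (real (Suc k) / real n) = y"
          by (auto simp: direct_jump_def)
        have "\<exists>u>0. left_limit ?w u = ?w (real k / real n) \<and> ?w u = ?w (real (Suc k) / real n)"
        proof (rule path_single_jump)
          show "right_continuous_path ?w" by fact
          show "real k / real n \<le> real (Suc k) / real n" by (intro divide_right_mono) auto
        qed (use k \<open>x \<noteq> y\<close> one in auto)
        then obtain u where "u > 0" "left_limit ?w u = x" "?w u = y" using k by auto
        moreover have "\<forall>t>0. d (left_limit ?w t) (?w t) \<le> b" by fact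
        ultimately show False using \<open>\<not> d x y \<le> b\<close> by blast
      qed
    qed
  qed
  then have "(\<lambda>n. \<integral>\<omega>. indicator (direct_jump x y n) \<omega> \<partial>P x) \<longlonglongrightarrow> (\<integral>\<omega>. (0::real) \<partial>P x)"
  proof (intro integral_dominated_convergence[where w = "\<lambda>_. 1"])
    assume *: "AE \<omega> in P x. \<forall>\<^sub>F n in sequentially. \<omega> \<notin> direct_jump x y n"
    then show "AE \<omega> in P x. (\<lambda>n. indicator (direct_jump x y n) \<omega> :: real) \<longlonglongrightarrow> 0"
      by eventually_elim (auto intro!: tendsto_eventually elim!: eventually_mono)
  qed (auto intro!: borel_measurable_indicator direct_jump_sets)
  then have lim0: "(\<lambda>n. prob (direct_jump x y n)) \<longlonglongrightarrow> 0"
    using direct_jump_sets sets.sets_into_space by (simp add: Int_absorb2)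
  let ?q = "exit_rate Q x"
  have h: "(\<lambda>n. 1 / real (Suc n)) \<longlonglongrightarrow> 0" by (rule LIMSEQ_Suc[OF lim_const_over_n])
  have "(\<lambda>n. (pmf (ker (1 / real (Suc n)) x) y - of_bool (x = y)) / (1 / real (Suc n))) \<longlonglongrightarrow> rate_matrix Q x y"
    by (rule rates_seq[OF h]) simp
  \<comment> \<open>The first factor bounds the holding probability along the grid from below; its
    positive limit forces \<open>Q x y\<close> to vanish.\<close>
  then have "(\<lambda>n. (1 + (- ?q) / real (Suc n)) ^ Suc n * (real (Suc n) * pmf (ker (1 / real (Suc n)) x) y)) \<longlonglongrightarrow> exp (- ?q) * Q x y"
    using \<open>x \<noteq> y\<close> by (intro tendsto_mult LIMSEQ_Suc[OF tendsto_exp_limit_sequentially]) (simp add: rate_matrix_def mult.commute)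
  moreover have "\<forall>\<^sub>F n in sequentially. (1 + (- ?q) / real (Suc n)) ^ Suc n * (real (Suc n) * pmf (ker (1 / real (Suc n)) x) y)
      \<le> prob (direct_jump x y (Suc n))"
  proof -
    \<comment> \<open>From \<open>N\<close> on the base of the power is nonnegative, as monotonicity
      of powers requires.\<close>
    obtain N where N: "?q \<le> real N" using real_arch_simple by blast
    show ?thesis
    proof (rule eventually_sequentiallyI[of N])
      fix n assume "N \<le> n"
      then have "?q \<le> real (Suc n)" using N by linarith
      then have 0: "0 \<le> 1 + (- ?q) / real (Suc n)" by (simp add: field_simps)
      have "1 - pmf (ker (1 / real (Suc n)) x) x \<le> 1 / real (Suc n) * ?q" by (rule leave_prob_le) simp
      then have "1 + (- ?q) / real (Suc n) \<le> pmf (ker (1 / real (Suc n)) x) x" by simp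
      then have "(1 + (- ?q) / real (Suc n)) ^ Suc n \<le> pmf (ker (1 / real (Suc n)) x) x ^ Suc n"
        using 0 by (rule power_mono)
      then have "(1 + (- ?q) / real (Suc n)) ^ Suc n * (real (Suc n) * pmf (ker (1 / real (Suc n)) x) y)
          \<le> pmf (ker (1 / real (Suc n)) x) x ^ Suc n * (real (Suc n) * pmf (ker (1 / real (Suc n)) x) y)"
        by (rule mult_right_mono) simp
      also have "\<dots> \<le> prob (direct_jump x y (Suc n))"
        using direct_jump_prob_ge[OF \<open>x \<noteq> y\<close>, of "Suc n"] by (simp only: mult.left_commute)
      finally show "(1 + (- ?q) / real (Suc n)) ^ Suc n * (real (Suc n) * pmf (ker (1 / real (Suc n)) x) y)
          \<le> prob (direct_jump x y (Suc n))" .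
    qed
  qed
  ultimately have "exp (- ?q) * Q x y \<le> 0"
    using LIMSEQ_Suc[OF lim0] by (intro tendsto_le[OF sequentially_bot]) auto
  moreover have "0 \<le> Q x y" using stable_Q \<open>x \<noteq> y\<close> by (auto simp: stable_rates_def)
  ultimately show ?thesis by (simp add: mult_le_0_iff)
qed

end

section \<open>Exponential moments and the carre du champ\<close>

text \<open>Equivalent to \<open>(1 + u) ln (1 + u) - u >= (u / 2) ln (1 + u)\<close>, which
  simplifies the optimal Chernoff exponent.\<close>

lemma two_mult_le_ln: assumes "0 \<le> u" shows "2 * u \<le> (2 + u) * ln (1 + u :: real)"
proof -
  define g where "g v = (2 + v) * ln (1 + v) - 2 * v" for v :: real
  have "g 0 \<le> g u"
  proof (rule DERIV_nonneg_imp_nondecreasing[OF assms])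
    fix v :: real assume v: "0 \<le> v" "v \<le> u"
    have "ln (1 / (1 + v)) \<le> 1 / (1 + v) - 1" using v by (intro ln_le_minus_one) auto
    then have "0 \<le> ln (1 + v) + (2 + v) / (1 + v) - 2"
      using v by (simp add: ln_div field_simps)
    moreover have "(g has_real_derivative ln (1 + v) + (2 + v) / (1 + v) - 2) (at v)"
      unfolding g_def using v by (auto intro!: derivative_eq_intros)
    ultimately show "\<exists>z. (g has_real_derivative z) (at v) \<and> 0 \<le> z" by blast
  qed
  then show ?thesis by (simp add: g_def)
qed

text \<open>For \<open>u >= 0\<close> this is the chord of the convex exponential. For
  \<open>u = - v < 0\<close> it reduces to that case by
  \<open>1 - exp (- a v) <= a v <= exp (a v) - 1\<close>.\<close>

lemma abs_exp_minus_one_le: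
  fixes a u c :: real
  assumes "0 \<le> a" "0 < c" "\<bar>u\<bar> \<le> c"
  shows "\<bar>exp (a * u) - 1\<bar> \<le> (exp (a * c) - 1) / c * \<bar>u\<bar>"
proof -
  have pos: "exp (a * v) - 1 \<le> (exp (a * c) - 1) / c * v" if "0 \<le> v" "v \<le> c" for v
  proof -
    have "exp ((1 - v / c) *\<^sub>R 0 + (v / c) *\<^sub>R (a * c)) \<le> (1 - v / c) * exp 0 + v / c * exp (a * c)"
      using that assms by (intro convex_onD[OF exp_convex]) auto
    moreover have "(1 - v / c) *\<^sub>R 0 + (v / c) *\<^sub>R (a * c) = a * v" using assms by simp
    moreover have "(1 - v / c) * exp 0 + v / c * exp (a * c) = 1 + (exp (a * c) - 1) / c * v"
      by (simp add: diff_divide_distrib algebra_simps)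
    ultimately show ?thesis by simp
  qed
  show ?thesis
  proof (cases "0 \<le> u")
    case True
    then show ?thesis using pos[of u] assms by simp
  next
    case False
    have "1 - exp (a * u) \<le> - (a * u)" using exp_ge_add_one_self[of "a * u"] by linarith
    also have "\<dots> \<le> exp (a * (- u)) - 1" using exp_ge_add_one_self[of "a * (- u)"] by simp
    also have "\<dots> \<le> (exp (a * c) - 1) / c * (- u)" using False assms by (intro pos) auto
    finally have "1 - exp (a * u) \<le> (exp (a * c) - 1) / c * \<bar>u\<bar>" using False by simp
    moreover have "a * u \<le> 0" using False assms by (simp add: mult_nonneg_nonpos)
    ultimately show ?thesis by simp
  qed
qed

lemma abs_exp_quadratic:
  fixes u :: real
  assumes "\<bar>u\<bar> \<le> 1" shows "\<bar>exp u - 1 - u\<bar> \<le> u\<^sup>2"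
proof -
  have "exp u \<le> 1 + u + u\<^sup>2"
  proof (cases "0 \<le> u")
    case True then show ?thesis using exp_bound[of u] assms by simp
  next
    case False
    define v where "v = - u"
    have v: "0 < v" using False by (simp add: v_def)
    have "exp u * (1 + v) \<le> exp u * exp v"
      using exp_ge_add_one_self[of v] by (intro mult_left_mono) auto
    also have "\<dots> = 1" by (simp add: v_def exp_minus)
    \<comment> \<open>The product equals \<open>1 + v^3\<close>.\<close>
    also have "\<dots> \<le> (1 - v + v\<^sup>2) * (1 + v)" using v by (simp add: algebra_simps power2_eq_square)
    finally have "exp u \<le> 1 - v + v\<^sup>2" using v by (simp add: mult_le_cancel_right)
    then show ?thesis by (simp add: v_def)
  qed
  then show ?thesis using exp_ge_add_one_self[of u] zero_le_power2[of u] by linarith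
qed

lemma bounded_fun_exp: "bounded_fun f \<Longrightarrow> bounded_fun (\<lambda>z. exp (a * f z))"
proof -
  assume "bounded_fun f"
  then obtain C where C: "\<And>x. \<bar>f x\<bar> \<le> C" "0 \<le> C" using bounded_funD by metis
  have "a * f x \<le> \<bar>a\<bar> * C" for x
  proof -
    have "a * f x \<le> \<bar>a * f x\<bar>" by simp
    also have "\<dots> \<le> \<bar>a\<bar> * C" unfolding abs_mult by (intro mult_left_mono C) simp
    finally show ?thesis .
  qed
  then show ?thesis by (intro bounded_funI[of _ "exp (\<bar>a\<bar> * C)"]) simp
qed

lemma abs_difference_quotient_le:
  fixes h :: real
  assumes "h \<noteq> 0" "\<bar>u - v - h * w\<bar> \<le> h\<^sup>2 * M"
  shows "\<bar>(u - v) / h - w\<bar> \<le> \<bar>h\<bar> * M"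
proof -
  have "h * ((u - v) / h - w) = u - v - h * w" using assms(1) by (simp add: field_simps)
  then have "\<bar>h\<bar> * \<bar>(u - v) / h - w\<bar> = \<bar>u - v - h * w\<bar>" by (simp only: abs_mult[symmetric])
  also have "\<dots> \<le> \<bar>h\<bar> * (\<bar>h\<bar> * M)" using assms(2) by (simp add: power2_eq_square)
  finally show ?thesis using assms(1) by simp
qed

lemma pmf_mgf_derivative:
  assumes f: "bounded_fun f"
  shows "((\<lambda>a. measure_pmf.expectation p (\<lambda>z. exp (a * f z))) has_real_derivative
    measure_pmf.expectation p (\<lambda>z. f z * exp (a * f z))) (at a)"
proof -
  obtain C where C: "\<And>x. \<bar>f x\<bar> \<le> C" "0 \<le> C" using bounded_funD[OF f] by metis
  let ?H = "\<lambda>a. measure_pmf.expectation p (\<lambda>z. exp (a * f z))"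
  let ?H' = "measure_pmf.expectation p (\<lambda>z. f z * exp (a * f z))"
  have int: "integrable p (\<lambda>z. exp (a * f z))" "integrable p (\<lambda>z. f z * exp (a * f z))"
    "integrable p (\<lambda>z. C\<^sup>2 * exp (a * f z))" for a
    by (intro integrable_measure_pmf_bounded bounded_fun_mult bounded_fun_const bounded_fun_exp f)+
  \<comment> \<open>The restriction on \<open>h\<close> gives \<open>|h * f z| <= 1\<close>, where
    the quadratic remainder bound for the exponential holds; \<open>C + 1\<close> also covers
    \<open>C = 0\<close>.\<close>
  have quad: "\<bar>(?H (a + h) - ?H a) / h - ?H'\<bar> \<le> \<bar>h\<bar> * (C\<^sup>2 * ?H a)" if h: "h \<noteq> 0" "\<bar>h\<bar> < 1 / (C + 1)" for h
  proof -
    have hC: "\<bar>h * f z\<bar> \<le> 1" for z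
    proof -
      have "\<bar>h * f z\<bar> \<le> 1 / (C + 1) * C" unfolding abs_mult using h C by (intro mult_mono) auto
      also have "\<dots> \<le> 1" using C by (simp add: field_simps)
      finally show ?thesis .
    qed
    have pt: "\<bar>exp ((a + h) * f z) - exp (a * f z) - h * (f z * exp (a * f z))\<bar> \<le> h\<^sup>2 * (C\<^sup>2 * exp (a * f z))" for z
    proof -
      have "exp ((a + h) * f z) - exp (a * f z) - h * (f z * exp (a * f z)) = exp (a * f z) * (exp (h * f z) - 1 - h * f z)"
        by (simp add: algebra_simps exp_add)
      also have "\<bar>\<dots>\<bar> \<le> exp (a * f z) * (h * f z)\<^sup>2"
        unfolding abs_mult abs_exp_cancel using abs_exp_quadratic[OF hC] by (intro mult_left_mono) auto
      also have "\<dots> \<le> exp (a * f z) * (h\<^sup>2 * C\<^sup>2)"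
      proof -
        have "(f z)\<^sup>2 \<le> C\<^sup>2" using power_mono[OF C(1)[of z], of 2] by simp
        then show ?thesis unfolding power_mult_distrib by (intro mult_left_mono) auto
      qed
      finally show ?thesis by (simp add: algebra_simps)
    qed
    let ?r = "\<lambda>z. exp ((a + h) * f z) - exp (a * f z) - h * (f z * exp (a * f z))"
    have i1: "integrable p (\<lambda>z. exp ((a + h) * f z) - exp (a * f z))"
      by (rule Bochner_Integration.integrable_diff[OF int(1) int(1)])
    have i2: "integrable p (\<lambda>z. h * (f z * exp (a * f z)))"
      using int(2) by (rule integrable_mult_right)
    have i3: "integrable p ?r" by (rule Bochner_Integration.integrable_diff[OF i1 i2])
    have i4: "integrable p (\<lambda>z. h\<^sup>2 * (C\<^sup>2 * exp (a * f z)))"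
      using int(3) by (rule integrable_mult_right)
    have "measure_pmf.expectation p ?r = ?H (a + h) - ?H a - h * ?H'"
      unfolding Bochner_Integration.integral_diff[OF i1 i2] Bochner_Integration.integral_diff[OF int(1) int(1)]
        Bochner_Integration.integral_mult_right_zero ..
    then have "\<bar>?H (a + h) - ?H a - h * ?H'\<bar> \<le> measure_pmf.expectation p (\<lambda>z. \<bar>?r z\<bar>)"
      using integral_abs_bound[of p ?r] by simp
    also have "\<dots> \<le> measure_pmf.expectation p (\<lambda>z. h\<^sup>2 * (C\<^sup>2 * exp (a * f z)))"
      by (rule integral_mono[OF integrable_abs[OF i3] i4 pt])
    also have "\<dots> = h\<^sup>2 * (C\<^sup>2 * ?H a)"
      unfolding Bochner_Integration.integral_mult_right_zero ..
    finally show ?thesis by (rule abs_difference_quotient_le[OF h(1)])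
  qed
  show ?thesis unfolding DERIV_def
  proof (rule LIM_zero_cancel, rule Lim_null_comparison)
    have "\<forall>\<^sub>F h in at 0. h \<noteq> 0 \<and> \<bar>h\<bar> < 1 / (C + 1)"
      unfolding eventually_at using C by (intro exI[of _ "1 / (C + 1)"]) (auto simp: dist_real_def)
    then show "\<forall>\<^sub>F h in at 0. norm ((?H (a + h) - ?H a) / h - ?H') \<le> \<bar>h\<bar> * (C\<^sup>2 * ?H a)"
      by (rule eventually_mono) (use quad in auto)
    show "((\<lambda>h. \<bar>h\<bar> * (C\<^sup>2 * ?H a)) \<longlongrightarrow> 0) (at 0)"
      by (rule tendsto_mult_left_zero) (rule tendsto_rabs_zero[OF tendsto_ident_at])
  qed
qed

section \<open>The carre du champ as a sum of squares\<close>

lemma Gam_eq_integral: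
  assumes 1: "integrable (count_space UNIV) (\<lambda>y. (f y - f x) * off_diag Q x y)"
    and 2: "integrable (count_space UNIV) (\<lambda>y. (f y * f y - f x * f x) * off_diag Q x y)"
  shows "integrable (count_space UNIV) (\<lambda>y. (f y - f x)\<^sup>2 * off_diag Q x y)"
    and "Gam Q f x = (\<integral>y. (f y - f x)\<^sup>2 * off_diag Q x y \<partial>count_space UNIV) / 2"
proof -
  have eq: "(f y - f x)\<^sup>2 * off_diag Q x y = (f y * f y - f x * f x) * off_diag Q x y
      - (2 * f x) * ((f y - f x) * off_diag Q x y)" for y
    by (simp add: power2_eq_square algebra_simps)
  show "integrable (count_space UNIV) (\<lambda>y. (f y - f x)\<^sup>2 * off_diag Q x y)"
    unfolding eq using 1 2 by (intro Bochner_Integration.integrable_diff integrable_mult_right)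
  have "(\<integral>y. (f y - f x)\<^sup>2 * off_diag Q x y \<partial>count_space UNIV) = gen Q (\<lambda>y. f y * f y) x - 2 * f x * gen Q f x"
    unfolding eq gen_eq_integral using 1 2
    by (subst Bochner_Integration.integral_diff) (auto intro!: integrable_mult_right)
  then show "Gam Q f x = (\<integral>y. (f y - f x)\<^sup>2 * off_diag Q x y \<partial>count_space UNIV) / 2"
    by (simp add: Gam_def Gam2_def)
qed

lemma Gam_nonneg_bounded:
  assumes "stable_rates Q" "bounded_fun f" shows "0 \<le> Gam Q f x"
proof -
  have "Gam Q f x = (\<integral>y. (f y - f x)\<^sup>2 * off_diag Q x y \<partial>count_space UNIV) / 2"
    by (rule Gam_eq_integral(2)[OF gen_integrable[OF assms] gen_integrable[OF assms(1) bounded_fun_mult[OF assms(2,2)]]])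
  moreover have "0 \<le> (\<integral>y. (f y - f x)\<^sup>2 * off_diag Q x y \<partial>count_space UNIV)"
    by (intro Bochner_Integration.integral_nonneg mult_nonneg_nonneg off_diag_nonneg assms(1)) simp
  ultimately show ?thesis by simp
qed

text \<open>Cauchy-Schwarz, from nonnegativity of the form at \<open>\<beta> u - \<alpha> v\<close>.
  Strictly positive majorants make the final division legitimate even if one of the two forms
  vanishes.\<close>

lemma Gam2_le_mult:
  assumes Q: "stable_rates Q" and u: "bounded_fun u" and v: "bounded_fun v"
    and a: "sqrt (Gam Q u x) \<le> \<alpha>" "0 < \<alpha>" and b: "sqrt (Gam Q v x) \<le> \<beta>" "0 < \<beta>"
  shows "Gam2 Q u v x \<le> \<alpha> * \<beta>"
proof -
  define w where "w = (\<lambda>z. \<beta> * u z - \<alpha> * v z)"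
  have bs: "bounded_fun (\<lambda>z. \<beta> * u z)" "bounded_fun (\<lambda>z. \<alpha> * v z)"
    by (intro bounded_fun_mult bounded_fun_const u v)+
  have w: "bounded_fun w" unfolding w_def by (intro bounded_fun_diff bs)
  have uu: "bounded_fun (\<lambda>z. u z * u z)" "bounded_fun (\<lambda>z. v z * v z)" "bounded_fun (\<lambda>z. u z * v z)"
    by (intro bounded_fun_mult u v)+
  have gw: "gen Q w x = \<beta> * gen Q u x - \<alpha> * gen Q v x"
    unfolding w_def using gen_diff[OF Q bs, of x] by (simp add: gen_scale)
  have "(\<lambda>z. w z * w z) = (\<lambda>z. (\<beta>\<^sup>2 * (u z * u z) + \<alpha>\<^sup>2 * (v z * v z)) - (2 * \<alpha> * \<beta>) * (u z * v z))"
    by (simp add: w_def fun_eq_iff power2_eq_square algebra_simps)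
  then have gww: "gen Q (\<lambda>z. w z * w z) x = \<beta>\<^sup>2 * gen Q (\<lambda>z. u z * u z) x + \<alpha>\<^sup>2 * gen Q (\<lambda>z. v z * v z) x
      - 2 * \<alpha> * \<beta> * gen Q (\<lambda>z. u z * v z) x"
    using gen_diff[OF Q bounded_fun_add[OF bounded_fun_mult[OF bounded_fun_const uu(1)] bounded_fun_mult[OF bounded_fun_const uu(2)]]
        bounded_fun_mult[OF bounded_fun_const uu(3)], of "\<beta>\<^sup>2" "\<alpha>\<^sup>2" "2 * \<alpha> * \<beta>" x]
      gen_add[OF Q bounded_fun_mult[OF bounded_fun_const uu(1)] bounded_fun_mult[OF bounded_fun_const uu(2)], of "\<beta>\<^sup>2" "\<alpha>\<^sup>2" x]
    by (simp only: gen_scale)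
  have "Gam Q w x = \<beta>\<^sup>2 * Gam Q u x + \<alpha>\<^sup>2 * Gam Q v x - 2 * \<alpha> * \<beta> * Gam2 Q u v x"
    unfolding Gam_def Gam2_def gw gww by (simp add: w_def power2_eq_square field_simps)
  then have "2 * (\<alpha> * \<beta>) * Gam2 Q u v x \<le> \<beta>\<^sup>2 * Gam Q u x + \<alpha>\<^sup>2 * Gam Q v x"
    using Gam_nonneg_bounded[OF Q w, of x] by simp
  also have "\<dots> \<le> \<beta>\<^sup>2 * \<alpha>\<^sup>2 + \<alpha>\<^sup>2 * \<beta>\<^sup>2"
    using sqrt_le_D[OF a(1)] sqrt_le_D[OF b(1)] by (intro add_mono mult_left_mono) auto
  also have "\<dots> = 2 * (\<alpha> * \<beta>) * (\<alpha> * \<beta>)" by (simp add: power2_eq_square algebra_simps)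
  finally show ?thesis using a(2) b(2) by (simp add: mult_le_cancel_left)
qed

context chain_algebra
begin

lemma
  assumes "f \<in> \<A>"
  shows Gam_algebra_integrable: "integrable (count_space UNIV) (\<lambda>y. (f y - f x)\<^sup>2 * off_diag Q x y)"
    and Gam_algebra_eq: "Gam Q f x = (\<integral>y. (f y - f x)\<^sup>2 * off_diag Q x y \<partial>count_space UNIV) / 2"
proof -
  have int: "integrable (count_space UNIV) (\<lambda>y. (g y - g x) * off_diag Q x y)" if "g \<in> \<A>" for g
  proof -
    have "(\<lambda>y. (g y - g x) * off_diag Q x y) = (\<lambda>y. (g y - g x) * Q x y)"
      by (auto simp: off_diag_def)
    then show ?thesis using gen_summable[OF that, of x] by (simp add: summable_on_iff_integrable_count_space)
  qed
  note * = Gam_eq_integral[OF int[OF assms] int[OF mult_closed[OF assms assms]]]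
  show "integrable (count_space UNIV) (\<lambda>y. (f y - f x)\<^sup>2 * off_diag Q x y)" by (rule *(1))
  show "Gam Q f x = (\<integral>y. (f y - f x)\<^sup>2 * off_diag Q x y \<partial>count_space UNIV) / 2" by (rule *(2))
qed

lemma Gam_contraction:
  assumes f: "f \<in> \<A>" and g: "bounded_fun g"
    and le: "\<And>y. off_diag Q x y \<noteq> 0 \<Longrightarrow> \<bar>g y - g x\<bar> \<le> k * \<bar>f y - f x\<bar>"
  shows "Gam Q g x \<le> k\<^sup>2 * Gam Q f x"
proof -
  have "(\<integral>y. (g y - g x)\<^sup>2 * off_diag Q x y \<partial>count_space UNIV)
      \<le> (\<integral>y. k\<^sup>2 * ((f y - f x)\<^sup>2 * off_diag Q x y) \<partial>count_space UNIV)"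
  proof (rule integral_mono)
    show "integrable (count_space UNIV) (\<lambda>y. (g y - g x)\<^sup>2 * off_diag Q x y)"
      by (rule Gam_algebra_integrable[OF bounded_mem[OF g]])
    show "integrable (count_space UNIV) (\<lambda>y. k\<^sup>2 * ((f y - f x)\<^sup>2 * off_diag Q x y))"
      by (rule integrable_mult_right) (rule Gam_algebra_integrable[OF f])
    fix y
    show "(g y - g x)\<^sup>2 * off_diag Q x y \<le> k\<^sup>2 * ((f y - f x)\<^sup>2 * off_diag Q x y)"
    proof (cases "off_diag Q x y = 0")
      case False
      have "(g y - g x)\<^sup>2 = \<bar>g y - g x\<bar>\<^sup>2" by simp
      also have "\<dots> \<le> (k * \<bar>f y - f x\<bar>)\<^sup>2" by (intro power_mono le False) simp
      finally have "(g y - g x)\<^sup>2 \<le> k\<^sup>2 * (f y - f x)\<^sup>2" by (simp add: power_mult_distrib)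
      from mult_right_mono[OF this off_diag_nonneg[OF stable_Q, of x y]] show ?thesis by (simp add: mult.assoc)
    qed simp
  qed
  then show ?thesis unfolding Gam_algebra_eq[OF f] Gam_algebra_eq[OF bounded_mem[OF g]] by simp
qed

lemma Gam_nonneg: "f \<in> \<A> \<Longrightarrow> 0 \<le> Gam Q f x"
  by (simp add: Gam_algebra_eq Bochner_Integration.integral_nonneg off_diag_nonneg[OF stable_Q])

end

section \<open>Deviation bound\<close>

lemma curv_time_pos:
  assumes "0 < t" shows "0 < curv_time t \<rho>"
proof (cases "\<rho> = 0")
  case False
  then consider "\<rho> > 0" | "\<rho> < 0" by linarith
  then show ?thesis
  proof cases
    case 1
    then have "exp (- 2 * \<rho> * t) < 1" using assms by simp
    then show ?thesis using 1 by (simp add: curv_time_def)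
  next
    case 2
    then have "1 < exp (- 2 * \<rho> * t)" using assms by (simp add: mult_neg_pos)
    then show ?thesis using 2 by (simp add: curv_time_def zero_less_divide_iff)
  qed
qed (simp add: curv_time_def assms)

text \<open>Each of the two functions evolved for time \<open>t - s\<close> contributes a factor
  \<open>exp (- \<rho> (t - s))\<close>; the leading 2 is the one in the derivative of
  \<open>interp\<close>.\<close>

lemma curv_time_antiderivative:
  obtains E :: "real \<Rightarrow> real"
  where "\<And>s. (E has_real_derivative 2 * exp (- 2 * \<rho> * (t - s))) (at s)" "E t - E 0 = 2 * curv_time t \<rho>"
proof (cases "\<rho> = 0")
  case True
  show ?thesis
    by (rule that[of "\<lambda>s. 2 * s"]) (use True in \<open>auto intro!: derivative_eq_intros simp: curv_time_def\<close>)
next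
  case False
  show ?thesis
  proof (rule that[of "\<lambda>s. exp (- 2 * \<rho> * (t - s)) / \<rho>"])
    show "((\<lambda>s. exp (- 2 * \<rho> * (t - s)) / \<rho>) has_real_derivative 2 * exp (- 2 * \<rho> * (t - s))) (at s)" for s
      using False by (auto intro!: derivative_eq_intros)
    show "exp (- 2 * \<rho> * (t - t)) / \<rho> - exp (- 2 * \<rho> * (t - 0)) / \<rho> = 2 * curv_time t \<rho>"
      using False by (simp add: curv_time_def field_simps)
  qed
qed

context chain_algebra
begin

context
  fixes \<rho> V c :: real and f :: "'e \<Rightarrow> real"
  assumes curv: "Gam_curvature_ge Q P X \<A> \<rho>"
    and f: "bounded_fun f"
    and V: "0 < V" "\<And>z. Gam Q f z \<le> V"
    and c: "0 < c" "\<And>x y. off_diag Q x y \<noteq> 0 \<Longrightarrow> \<bar>f y - f x\<bar> \<le> c"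
begin

definition slope :: "real \<Rightarrow> real" where
  "slope a = (exp (a * c) - 1) / c"

lemma sqrt_Gam_exp_le:
  assumes "0 \<le> a"
  shows "sqrt (Gam Q (\<lambda>y. exp (a * f y)) z) \<le> sqrt V * slope a * exp (a * f z)"
proof -
  have "0 \<le> slope a" using assms c by (simp add: slope_def)
  have "Gam Q (\<lambda>y. exp (a * f y)) z \<le> (exp (a * f z) * slope a)\<^sup>2 * Gam Q f z"
  proof (rule Gam_contraction[OF bounded_mem[OF f] bounded_fun_exp[OF f]])
    fix y assume "off_diag Q z y \<noteq> 0"
    have "exp (a * f y) - exp (a * f z) = exp (a * f z) * (exp (a * (f y - f z)) - 1)"
      by (simp add: right_diff_distrib exp_diff)
    then have "\<bar>exp (a * f y) - exp (a * f z)\<bar> = exp (a * f z) * \<bar>exp (a * (f y - f z)) - 1\<bar>"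
      by (simp only: abs_mult abs_exp_cancel)
    also have "\<dots> \<le> exp (a * f z) * (slope a * \<bar>f y - f z\<bar>)"
      unfolding slope_def by (intro mult_left_mono abs_exp_minus_one_le assms c \<open>off_diag Q z y \<noteq> 0\<close>) auto
    finally show "\<bar>exp (a * f y) - exp (a * f z)\<bar> \<le> exp (a * f z) * slope a * \<bar>f y - f z\<bar>"
      by (simp add: mult.assoc)
  qed
  also have "\<dots> \<le> (exp (a * f z) * slope a)\<^sup>2 * V" by (intro mult_left_mono V) auto
  finally have "sqrt (Gam Q (\<lambda>y. exp (a * f y)) z) \<le> sqrt ((exp (a * f z) * slope a)\<^sup>2 * V)" by simp
  also have "\<dots> = sqrt V * slope a * exp (a * f z)"
    using \<open>0 \<le> slope a\<close> by (simp add: real_sqrt_mult)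
  finally show ?thesis .
qed

text \<open>A bounded majorant \<open>G\<close> replaces the possibly unbounded root. Time 0 is
  treated apart because the curvature bound concerns positive times.\<close>

lemma sqrt_Gam_T_le:
  assumes "0 \<le> r" and g: "bounded_fun g" and G: "bounded_fun G" and le: "\<And>z. sqrt (Gam Q g z) \<le> G z"
  shows "sqrt (Gam Q (T r g) z) \<le> exp (- \<rho> * r) * T r G z"
proof (cases "r = 0")
  case True
  then show ?thesis using le by simp
next
  case False
  with \<open>0 \<le> r\<close> have "0 < r" by simp
  then have "sqrt (Gam Q (T r g) z) \<le> exp (- \<rho> * r) * T r (\<lambda>z. sqrt (Gam Q g z)) z"
    using curv bounded_mem[OF g] by (simp add: Gam_curvature_ge_def T_eq_semigroup_op)
  also have "T r (\<lambda>z. sqrt (Gam Q g z)) z \<le> T r G z"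
    unfolding T_def
  proof (rule integral_mono')
    \<comment> \<open>A non-integrable left side would have integral 0 by convention, so
      \<open>integral_mono'\<close> asks for \<open>G >= 0\<close> instead of its
      integrability.\<close>
    show "0 \<le> G y" for y
      using Gam_nonneg[OF bounded_mem[OF g], of y] by (intro order_trans[OF _ le]) simp
  qed (use le in \<open>auto intro: integrable_measure_pmf_bounded G\<close>)
  finally show ?thesis by simp
qed

lemma T_pos:
  assumes "bounded_fun g" "0 < e" "\<And>z. e \<le> g z" shows "0 < T r g z"
proof -
  have "e \<le> T r g z" unfolding T_def
    using assms by (intro measure_pmf.integral_ge_const integrable_measure_pmf_bounded) auto
  then show ?thesis using assms by simp
qed

lemma mgf_pos: "0 < T r (\<lambda>y. exp (a * f y)) z"
proof -
  obtain C where C: "\<And>x. \<bar>f x\<bar> \<le> C" "0 \<le> C" using bounded_funD[OF f] by metis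
  have "exp (- (\<bar>a\<bar> * C)) \<le> exp (a * f z)" for z
  proof -
    have "\<bar>a * f z\<bar> \<le> \<bar>a\<bar> * C" unfolding abs_mult by (intro mult_left_mono C) simp
    then show ?thesis by simp
  qed
  then show ?thesis by (intro T_pos[where e = "exp (- (\<bar>a\<bar> * C))"] bounded_fun_exp f) auto
qed

lemma cov_exp_le:
  assumes "0 < t" "0 < a"
  shows "cov t f (\<lambda>y. exp (a * f y)) x \<le> 2 * curv_time t \<rho> * V * slope a * T t (\<lambda>y. exp (a * f y)) x"
proof -
  let ?g = "\<lambda>y. exp (a * f y)"
  have g: "bounded_fun ?g" by (rule bounded_fun_exp[OF f])
  have sl: "0 < slope a" using assms c by (simp add: slope_def)
  define M where "M = V * slope a * T t ?g x"
  obtain E :: "real \<Rightarrow> real" where E: "\<And>s. (E has_real_derivative 2 * exp (- 2 * \<rho> * (t - s))) (at s)"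
    "E t - E 0 = 2 * curv_time t \<rho>" using curv_time_antiderivative[of \<rho> t] by metis
  have Gam2_le: "Gam2 Q (T r f) (T r ?g) z \<le> exp (- 2 * \<rho> * r) * V * slope a * T r ?g z" if "0 \<le> r" for r z
  proof -
    have 1: "sqrt (Gam Q (T r f) z) \<le> exp (- \<rho> * r) * sqrt V"
      using sqrt_Gam_T_le[OF that f bounded_fun_const[of "sqrt V"], of z] V by (simp add: T_def)
    have "sqrt (Gam Q (T r ?g) z) \<le> exp (- \<rho> * r) * T r (\<lambda>y. sqrt V * slope a * ?g y) z"
      using assms(2) by (intro sqrt_Gam_T_le that g bounded_fun_mult[OF bounded_fun_const] sqrt_Gam_exp_le) simp
    then have 2: "sqrt (Gam Q (T r ?g) z) \<le> exp (- \<rho> * r) * (sqrt V * slope a * T r ?g z)"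
      by (simp add: T_def)
    have "Gam2 Q (T r f) (T r ?g) z \<le> exp (- \<rho> * r) * sqrt V * (exp (- \<rho> * r) * (sqrt V * slope a * T r ?g z))"
      by (rule Gam2_le_mult[OF stable_Q bounded_T[OF f] bounded_T[OF g] 1 _ 2]) (use V sl mgf_pos in auto)
    also have "\<dots> = (exp (- \<rho> * r) * exp (- \<rho> * r)) * (sqrt V * sqrt V) * slope a * T r ?g z"
      by (simp add: algebra_simps)
    also have "exp (- \<rho> * r) * exp (- \<rho> * r) = exp (- 2 * \<rho> * r)" by (simp add: exp_add[symmetric])
    also have "sqrt V * sqrt V = V" using V by simp
    finally show ?thesis .
  qed
  have "cov t f ?g x \<le> M * E t - M * E 0"
  proof (rule covariance_le[OF _ f g])
    show "((\<lambda>s. M * E s) has_real_derivative M * (2 * exp (- 2 * \<rho> * (t - s)))) (at s)" for s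
      by (rule DERIV_cmult) (rule E)
    fix s assume s: "0 < s" "s \<le> t"
    have "T s (Gam2 Q (T (t - s) f) (T (t - s) ?g)) x
        \<le> T s (\<lambda>z. exp (- 2 * \<rho> * (t - s)) * V * slope a * T (t - s) ?g z) x"
      unfolding T_def[of s]
      using s by (intro integral_mono Gam2_le Gam2_integrable integrable_measure_pmf_bounded bounded_T f g
          bounded_fun_mult[OF bounded_fun_const]) auto
    also have "\<dots> = exp (- 2 * \<rho> * (t - s)) * V * slope a * T s (T (t - s) ?g) x"
      by (simp add: T_def[of s])
    \<comment> \<open>The dependence on \<open>s\<close> through the evolved exponential disappears,
      leaving only the explicit curvature factor to integrate.\<close>
    also have "T s (T (t - s) ?g) x = T t ?g x"
      using T_add[of s "t - s" ?g x] s g by simp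
    finally show "2 * T s (Gam2 Q (T (t - s) f) (T (t - s) ?g)) x \<le> M * (2 * exp (- 2 * \<rho> * (t - s)))"
      by (simp add: M_def algebra_simps)
  qed (use assms in simp)
  also have "\<dots> = M * (2 * curv_time t \<rho>)" unfolding E(2)[symmetric] by (simp add: right_diff_distrib)
  finally show ?thesis by (simp add: M_def algebra_simps)
qed

text \<open>The derivative of the logarithm of the Laplace transform, minus the mean, is the
  covariance of \<open>f\<close> and \<open>exp (v f)\<close> divided by the transform. By
  \<open>cov_exp_le\<close> it is at most a multiple of \<open>slope v\<close>, which has an
  explicit antiderivative.\<close>

lemma mgf_le:
  assumes "0 < t" "0 \<le> a"
  shows "T t (\<lambda>y. exp (a * f y)) x
    \<le> exp (a * T t f x + 2 * curv_time t \<rho> * V * (exp (a * c) - 1 - a * c) / c\<^sup>2)"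
proof -
  define H where "H a = T t (\<lambda>y. exp (a * f y)) x" for a
  define H' where "H' a = T t (\<lambda>y. f y * exp (a * f y)) x" for a
  define K where "K = 2 * curv_time t \<rho> * V"
  define k where "k = K / c\<^sup>2"
  define D where "D a = ln (H a) - a * T t f x - k * (exp (a * c) - 1 - a * c)" for a
  have H_pos: "0 < H a" for a unfolding H_def by (rule mgf_pos)
  have H_deriv: "(H has_real_derivative H' a) (at a)" for a
    unfolding H_def H'_def T_def by (rule pmf_mgf_derivative[OF f])
  have "D a \<le> D 0"
  proof (rule DERIV_nonpos_imp_nonincreasing[OF assms(2)])
    fix v :: real assume v: "0 \<le> v" "v \<le> a"
    have cov: "cov t f (\<lambda>y. exp (v * f y)) x = H' v - T t f x * H v"
      by (simp add: cov_def H_def H'_def)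
    have "H' v - T t f x * H v \<le> K * slope v * H v"
    proof (cases "v = 0")
      \<comment> \<open>\<open>cov_exp_le\<close> needs a positive parameter; at 0 both sides
        vanish.\<close>
      case True
      then show ?thesis by (simp add: H_def H'_def slope_def T_def)
    next
      case False
      then show ?thesis
        using cov_exp_le[of t v x] v assms unfolding cov K_def H_def by simp
    qed
    then have "H' v / H v - T t f x - K * slope v \<le> 0"
      using H_pos[of v] by (simp add: field_simps)
    moreover have "(D has_real_derivative H' v / H v - T t f x - K * slope v) (at v)"
    proof -
      have "(D has_real_derivative H' v / H v - T t f x - k * (exp (v * c) * c - c)) (at v)"
        unfolding D_def using H_pos[of v] by (auto intro!: derivative_eq_intros H_deriv)
      moreover have "k * (exp (v * c) * c - c) = K * slope v"
        using c by (simp add: k_def slope_def power2_eq_square field_simps)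
      ultimately show ?thesis by simp
    qed
    ultimately show "\<exists>z. (D has_real_derivative z) (at v) \<and> z \<le> 0" by blast
  qed
  also have "D 0 = 0" by (simp add: D_def H_def T_def)
  finally have "ln (H a) \<le> a * T t f x + K * (exp (a * c) - 1 - a * c) / c\<^sup>2"
    by (simp add: D_def k_def)
  then have "exp (ln (H a)) \<le> exp (a * T t f x + K * (exp (a * c) - 1 - a * c) / c\<^sup>2)" by simp
  then show ?thesis unfolding exp_ln[OF H_pos] by (simp only: H_def K_def)
qed

end

text \<open>Arbitrary positive majorants \<open>V\<close> and \<open>c\<close> are allowed, so that
  the degenerate case of a vanishing carre du champ can be reached by letting \<open>V\<close> tend
  to 0.\<close>

lemma tail_bound:
  assumes curv: "Gam_curvature_ge Q P X \<A> \<rho>" and f: "f \<in> \<A>"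
    and V: "0 < V" "\<And>z. Gam Q f z \<le> V"
    and c: "0 < c" "\<And>x y. off_diag Q x y \<noteq> 0 \<Longrightarrow> \<bar>f y - f x\<bar> \<le> c"
    and "0 < t" "0 < y"
  shows "measure_pmf.prob (ker t x) {z. y \<le> f z - T t f x}
    \<le> exp (- (y / (2 * c)) * ln (1 + y * c / (2 * curv_time t \<rho> * V)))"
proof -
  define K where "K = 2 * curv_time t \<rho> * V"
  have "0 < K" unfolding K_def using curv_time_pos[OF \<open>0 < t\<close>] V by simp
  define u where "u = y * c / K"
  have "0 < u" using \<open>0 < K\<close> \<open>0 < y\<close> c by (simp add: u_def)
  \<comment> \<open>The minimiser of \<open>K (exp (a c) - 1 - a c) / c^2 - a y\<close>: its
    derivative vanishes where \<open>exp (a c) = 1 + u\<close>.\<close>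
  define a where "a = ln (1 + u) / c"
  have "0 \<le> a" using \<open>0 < u\<close> c by (simp add: a_def)
  have exp_a: "exp (a * c) = 1 + u" using \<open>0 < u\<close> c by (simp add: a_def)
  define B where "B = exp (K * (exp (a * c) - 1 - a * c) / c\<^sup>2)"
  define m where "m = T t f x"
  \<comment> \<open>Truncation does not increase differences, so \<open>g n\<close> inherits both
    bounds \<open>V\<close> and \<open>c\<close> from \<open>f\<close>.\<close>
  define g where "g n z = max (- real n) (min (real n) (f z))" for n z
  define m' where "m' n = T t (g n) x" for n
  have g: "bounded_fun (g n)" for n
    by (rule bounded_funI[of _ "real n"]) (auto simp: g_def)
  have g_diff: "\<bar>g n y - g n x\<bar> \<le> \<bar>f y - f x\<bar>" for n x y by (auto simp: g_def)
  have mgf: "T t (\<lambda>y. exp (a * g n y)) x \<le> exp (a * m' n) * B" for n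
  proof -
    have "Gam Q (g n) z \<le> V" for z
      using Gam_contraction[OF f g[of n], of z 1] g_diff[of n] V(2)[of z] by simp
    from mgf_le[OF curv g V(1) this c(1) _ \<open>0 < t\<close> \<open>0 \<le> a\<close>, of x]
    show ?thesis using order_trans[OF g_diff c(2)] by (simp add: m'_def B_def K_def exp_add)
  qed
  have f_int: "integrable (ker t x) f"
    using semigroup_integrable[OF f, of t x] \<open>0 < t\<close> by (simp add: integrable_ker)
  have m'_lim: "m' \<longlonglongrightarrow> m"
    unfolding m'_def m_def T_def
  proof (rule integral_dominated_convergence[where w = "\<lambda>z. \<bar>f z\<bar>"])
    show "AE z in ker t x. (\<lambda>n. g n z) \<longlonglongrightarrow> f z"
    proof (rule AE_I2, rule tendsto_eventually)
      fix z
      obtain N where N: "\<bar>f z\<bar> \<le> real N" using real_arch_simple by blast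
      show "\<forall>\<^sub>F n in sequentially. g n z = f z"
        using N by (intro eventually_sequentiallyI[of N]) (auto simp: g_def)
    qed
  qed (use f_int in \<open>auto simp: g_def\<close>)
  \<comment> \<open>On \<open>A N\<close> every truncation from level \<open>N\<close> on equals
    \<open>f\<close>. The means can thus converge with \<open>N\<close> fixed, before
    \<open>N\<close> tends to infinity.\<close>
  define A where "A N = {z. y \<le> f z - m \<and> \<bar>f z\<bar> \<le> real N}" for N
  have trunc: "measure_pmf.prob (ker t x) (A N) * exp (a * (y + m - m' n)) \<le> B" if "N \<le> n" for N n
  proof -
    have "measure_pmf.prob (ker t x) (A N) * exp (a * (y + m))
        = measure_pmf.expectation (ker t x) (\<lambda>z. exp (a * (y + m)) * indicator (A N) z)"
      by simp
    also have "\<dots> \<le> measure_pmf.expectation (ker t x) (\<lambda>z. exp (a * g n z))"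
    proof (rule integral_mono')
      show "exp (a * (y + m)) * indicator (A N) z \<le> exp (a * g n z)" for z
      proof (cases "z \<in> A N")
        case True
        then have "g n z = f z" "y + m \<le> f z" using that by (auto simp: A_def g_def)
        then show ?thesis using True \<open>0 \<le> a\<close> by (simp add: mult_left_mono)
      qed simp
    qed (auto intro: integrable_measure_pmf_bounded bounded_fun_exp g)
    also have "\<dots> \<le> exp (a * m' n) * B" using mgf by (simp add: T_def)
    finally have "measure_pmf.prob (ker t x) (A N) * exp (a * (y + m)) * exp (- (a * m' n)) \<le> exp (a * m' n) * B * exp (- (a * m' n))"
      by (rule mult_right_mono) simp
    moreover have "exp (a * (y + m - m' n)) = exp (a * (y + m)) * exp (- (a * m' n))"
      by (simp add: exp_add[symmetric] right_diff_distrib)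
    moreover have "exp (a * m' n) * B * exp (- (a * m' n)) = B" by (simp add: exp_minus)
    ultimately show ?thesis by (simp only: mult.assoc)
  qed
  have A_le: "measure_pmf.prob (ker t x) (A N) * exp (a * y) \<le> B" for N
  proof (rule LIMSEQ_le_const2)
    have "(\<lambda>n. measure_pmf.prob (ker t x) (A N) * exp (a * (y + m - m' n)))
        \<longlonglongrightarrow> measure_pmf.prob (ker t x) (A N) * exp (a * (y + m - m))"
      by (intro tendsto_intros m'_lim)
    then show "(\<lambda>n. measure_pmf.prob (ker t x) (A N) * exp (a * (y + m - m' n)))
        \<longlonglongrightarrow> measure_pmf.prob (ker t x) (A N) * exp (a * y)" by simp
  qed (use trunc in blast)
  have "(\<lambda>N. measure_pmf.prob (ker t x) (A N)) \<longlonglongrightarrow> measure_pmf.prob (ker t x) (\<Union>N. A N)"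
    by (rule measure_pmf.finite_Lim_measure_incseq) (auto simp: A_def incseq_def)
  from tendsto_mult[OF this tendsto_const[of "exp (a * y)"]]
  have "measure_pmf.prob (ker t x) (\<Union>N. A N) * exp (a * y) \<le> B"
    by (rule LIMSEQ_le_const2) (use A_le in blast)
  moreover have "(\<Union>N. A N) = {z. y \<le> f z - T t f x}"
  proof -
    have "\<exists>N. \<bar>f z\<bar> \<le> real N" for z by (rule real_arch_simple)
    then show ?thesis unfolding A_def m_def by blast
  qed
  ultimately have "measure_pmf.prob (ker t x) {z. y \<le> f z - T t f x} \<le> B * exp (- (a * y))"
    by (simp add: exp_minus field_simps)
  also have "\<dots> = exp (K * (exp (a * c) - 1 - a * c) / c\<^sup>2 - a * y)"
    by (simp add: B_def exp_add[symmetric])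
  also have "\<dots> \<le> exp (- (y / (2 * c)) * ln (1 + u))"
  proof -
    have Ku: "K * u = y * c" using \<open>0 < K\<close> by (simp add: u_def)
    have "2 * (K * u) \<le> K * ((2 + u) * ln (1 + u))"
      using two_mult_le_ln[of u] \<open>0 < u\<close> \<open>0 < K\<close> by simp
    also have "\<dots> = 2 * K * ln (1 + u) + K * u * ln (1 + u)" by (simp add: algebra_simps)
    finally have "2 * (K * u - K * ln (1 + u)) \<le> y * c * ln (1 + u)" unfolding Ku by simp
    then have "(K * u - K * ln (1 + u)) / c\<^sup>2 \<le> (y * c * ln (1 + u) / 2) / c\<^sup>2"
      by (intro divide_right_mono) auto
    also have "\<dots> = y / (2 * c) * ln (1 + u)" using c by (simp add: power2_eq_square)
    finally have "(K * u - K * ln (1 + u)) / c\<^sup>2 \<le> y / (2 * c) * ln (1 + u)" .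
    moreover have "K * (exp (a * c) - 1 - a * c) / c\<^sup>2 = (K * u - K * ln (1 + u)) / c\<^sup>2"
      unfolding exp_a using c by (simp add: a_def right_diff_distrib)
    moreover have "a * y = 2 * (y / (2 * c) * ln (1 + u))" by (simp add: a_def)
    moreover have "- (y / (2 * c)) * ln (1 + u) = - (y / (2 * c) * ln (1 + u))" by simp
    ultimately have "K * (exp (a * c) - 1 - a * c) / c\<^sup>2 - a * y \<le> - (y / (2 * c)) * ln (1 + u)"
      by linarith
    then show ?thesis by simp
  qed
  finally show ?thesis by (simp add: u_def K_def)
qed

end

lemma abs_diff_le_lip_norm:
  assumes d: "Metric_space UNIV d" and f: "f \<in> Lip d" and "x \<noteq> y"
  shows "\<bar>f x - f y\<bar> \<le> lip_norm d f * d x y"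
proof -
  have "0 < d x y"
    using Metric_space.mdist_pos_less[OF d \<open>x \<noteq> y\<close>] by simp
  moreover have "\<bar>f x - f y\<bar> / d x y \<le> lip_norm d f"
    unfolding lip_norm_def using f \<open>x \<noteq> y\<close>
    by (intro cSup_upper) (auto simp: Lip_def lip_quotients_def)
  ultimately show ?thesis by (simp add: divide_le_eq)
qed

(* If Gam Q f vanishes identically, the argument of the logarithm is y * b * lip_norm d f / 0 = oo
   and the bound is read as exp (-oo) = 0; HOL's convention r / 0 = 0 would give the empty bound 1.
   This also covers lip_norm d f = 0, where f is constant. *)
theorem corollary3p6:
  fixes d :: "'e::countable \<Rightarrow> 'e \<Rightarrow> real"
    and Q :: "'e \<Rightarrow> 'e \<Rightarrow> real"
    and P :: "'e \<Rightarrow> 'w measure"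
    and X :: "real \<Rightarrow> 'w \<Rightarrow> 'e"
    and \<A> :: "('e \<Rightarrow> real) set"
    and f :: "'e \<Rightarrow> real"
    and \<rho> b t y :: real
    and x :: 'e
  assumes "Metric_space UNIV d" and "d \<noteq> trivial_metric"
    and "regular_nonexplosive_chain Q P X"
    and "chain_algebra Q P X \<A>"
    and "Gam_curvature_ge Q P X \<A> \<rho>"
    and "b > 0" and "jumps_bounded_by d P X b"
    and "f \<in> \<A> \<inter> Lip d"
    and "bounded_fun (Gam Q f)"
    and "t > 0" and "y > 0"
  shows "measure (P x) {\<omega> \<in> space (P x). f (X t \<omega>) - (\<integral>\<omega>'. f (X t \<omega>') \<partial>P x) \<ge> y}
    \<le> (if sup_norm (Gam Q f) = 0 then 0
        else exp (- (y / (2 * b * lip_norm d f)) *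
               ln (1 + y * b * lip_norm d f / (2 * curv_time t \<rho> * sup_norm (Gam Q f)))))"
proof -
  interpret chain_algebra Q P X \<A> by fact
  have f: "f \<in> \<A>" "f \<in> Lip d" using assms by auto
  have prob_eq: "measure (P x) {\<omega> \<in> space (P x). f (X t \<omega>) - (\<integral>\<omega>'. f (X t \<omega>') \<partial>P x) \<ge> y}
      = measure_pmf.prob (ker t x) {z. y \<le> f z - T t f x}" (is "?p = ?p'")
  proof -
    have T_f: "T t f x = (\<integral>\<omega>'. f (X t \<omega>') \<partial>P x)"
      using \<open>t > 0\<close> by (simp add: T_eq_semigroup_op semigroup_op_def)
    have "?p' = measure (P x) (X t -` {z. y \<le> f z - T t f x} \<inter> space (P x))"
      using \<open>t > 0\<close> by (simp add: measure_pmf_ker measure_distr[OF measurable_X])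
    also have "X t -` {z. y \<le> f z - T t f x} \<inter> space (P x) = {\<omega> \<in> space (P x). f (X t \<omega>) - T t f x \<ge> y}" by auto
    finally show ?thesis by (simp only: T_f)
  qed
  have jump: "\<bar>f z - f w\<bar> \<le> b * lip_norm d f" if "off_diag Q w z \<noteq> 0" for w z
  proof -
    have wz: "w \<noteq> z" "Q w z \<noteq> 0" using that by (auto simp: off_diag_def split: if_splits)
    then have "d w z \<le> b" using jump_rate_zero[OF assms(7)] by blast
    have le: "\<bar>f w - f z\<bar> \<le> lip_norm d f * d w z" by (rule abs_diff_le_lip_norm[OF assms(1) f(2) wz(1)])
    \<comment> \<open>As a supremum, \<open>lip_norm d f\<close> is meaningful only when two
      distinct points exist; the pair \<open>w\<close>, \<open>z\<close> supplies them and yields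
      its nonnegativity.\<close>
    have "0 < d w z" using Metric_space.mdist_pos_less[OF assms(1) wz(1)] by simp
    then have "0 \<le> lip_norm d f"
      using order_trans[OF abs_ge_zero le] by (simp add: zero_le_mult_iff)
    then have "lip_norm d f * d w z \<le> lip_norm d f * b" using \<open>d w z \<le> b\<close> by (intro mult_left_mono)
    then show ?thesis using le by (simp add: abs_minus_commute mult.commute)
  qed
  have Gam_le: "Gam Q f z \<le> sup_norm (Gam Q f)" for z
  proof -
    have "\<bar>Gam Q f z\<bar> \<le> sup_norm (Gam Q f)"
      unfolding sup_norm_def using assms(9) by (intro cSUP_upper) (auto simp: bounded_fun_def)
    then show ?thesis by linarith
  qed
  have L: "0 < curv_time t \<rho>" by (rule curv_time_pos) fact
  show ?thesis
  proof (cases "sup_norm (Gam Q f) = 0")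
    case True
    \<comment> \<open>\<open>b * lip_norm d f\<close> may be 0; the maximum with 1 keeps
      \<open>c\<close> positive, and its size does not affect the limit.\<close>
    define c where "c = max 1 (b * lip_norm d f)"
    have c: "0 < c" "\<And>w z. off_diag Q w z \<noteq> 0 \<Longrightarrow> \<bar>f z - f w\<bar> \<le> c"
      using jump by (auto simp: c_def le_max_iff_disj)
    have le: "?p' \<le> exp (- (y / (2 * c)) * real (Suc n))" for n
    proof -
      \<comment> \<open>Solves \<open>ln (1 + y c / (2 L V)) = n + 1\<close> with
        \<open>L = curv_time t \<rho>\<close>. Any positive \<open>V\<close> is admissible here;
        \<open>Suc n\<close> keeps the denominator nonzero.\<close>
      define V where "V = y * c / (2 * curv_time t \<rho> * (exp (real (Suc n)) - 1))"
      have "0 < V" unfolding V_def using L c \<open>y > 0\<close> by simp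
      moreover have "Gam Q f z \<le> V" for z using Gam_le[of z] True \<open>0 < V\<close> by simp
      ultimately have "?p' \<le> exp (- (y / (2 * c)) * ln (1 + y * c / (2 * curv_time t \<rho> * V)))"
        by (intro tail_bound assms(5) f(1) c assms(10,11))
      also have "y * c / (2 * curv_time t \<rho> * V) = exp (real (Suc n)) - 1"
        unfolding V_def using L c \<open>y > 0\<close> by simp
      finally show ?thesis by simp
    qed
    have "(\<lambda>n. exp (- (y / (2 * c)) * real (Suc n))) \<longlonglongrightarrow> 0"
    proof -
      have "filterlim (\<lambda>n. real (Suc n)) at_top sequentially"
        by (rule filterlim_compose[OF filterlim_real_sequentially filterlim_Suc])
      then have "filterlim (\<lambda>n. - (y / (2 * c)) * real (Suc n)) at_bot sequentially"
        using \<open>y > 0\<close> c by (intro filterlim_tendsto_neg_mult_at_bot[OF tendsto_const]) auto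
      then show ?thesis by (rule filterlim_compose[OF exp_at_bot])
    qed
    then have "?p' \<le> 0" using le by (intro LIMSEQ_le_const) auto
    then show ?thesis using True unfolding prob_eq by simp
  next
    case False
    have "0 \<le> sup_norm (Gam Q f)" using order_trans[OF Gam_nonneg[OF f(1)] Gam_le] .
    then have V: "0 < sup_norm (Gam Q f)" using False by simp
    \<comment> \<open>Otherwise no transition with positive rate would change \<open>f\<close>, and
      its carre du champ would vanish identically.\<close>
    have "0 < b * lip_norm d f"
    proof (rule ccontr)
      assume "\<not> ?thesis"
      then have 0: "(f z - f w)\<^sup>2 * off_diag Q w z = 0" for w z using jump[of w z] by fastforce
      have "Gam Q f w = 0" for w unfolding Gam_algebra_eq[OF f(1)] 0 by simp
      then show False using False by (simp add: sup_norm_def)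
    qed
    then have "?p' \<le> exp (- (y / (2 * (b * lip_norm d f)))
        * ln (1 + y * (b * lip_norm d f) / (2 * curv_time t \<rho> * sup_norm (Gam Q f))))"
      using assms(10,11) by (intro tail_bound assms(5) f(1) V Gam_le jump)
    then show ?thesis using False unfolding prob_eq by (simp add: mult.assoc)
  qed
qed

end
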